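(* Assume the following hypothesis $(\mathrm{H}_3)$: for every $n\ge3$, every $\rho\in[-1,0]$ and every measurable $f:\mathbb{R}^n\to B^3$, $\mathrm{Stab}_\rho[f]\ge\mathrm{Stab}_\rho[f^{(3)}_{\mathrm{opt}}]$, where $f^{(3)}_{\mathrm{opt}}(x)=(x_1,x_2,x_3)/\|(x_1,x_2,x_3)\|$. Then \[\inf_G\frac{\mathrm{Prod}(G)}{\mathrm{SDP}_{\mathrm{Prod}}(G)}=\alpha_{\mathrm{BOV}},\] the infimum being over all weighted graphs $G$.
   Context: $\mathbf{x}\sim_\rho\mathbf{y}$ are $\rho$-correlated standard Gaussian vectors in $\mathbb{R}^n$ and $\mathrm{Stab}_\rho[f]=\mathbb{E}\langle f(\mathbf{x}),f(\mathbf{y})\rangle$. A weighted graph $G=(V,E,w)$ is a finite undirected graph with nonnegative edge weights summing to $1$; $(\mathbf{u},\mathbf{v})\sim E$ is a random edge. $\mathrm{Prod}(G)=\max_{f:V\to S^2}\mathbb{E}[\tfrac14-\tfrac14\langle f(\mathbf{u}),f(\mathbf{v})\rangle]$ and $\mathrm{SDP}_{\mathrm{Prod}}(G)=\max_{f:V\to S^{|V|-1}}\mathbb{E}[\tfrac14-\tfrac14\langle f(\mathbf{u}),f(\mathbf{v})\rangle]$. $F^*(k,\rho)=\mathbb{E}\langle\mathbf{Z}u/\|\mathbf{Z}u\|,\mathbf{Z}v/\|\mathbf{Z}v\|\rangle$ for unit $u,v$ with $\langle u,v\rangle=\rho$ and $\mathbf{Z}$ a $k\times m$ standard Gaussian matrix;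 $\alpha_{\mathrm{BOV}}=\min_{-1\le\rho<1}\frac{1-F^*(3,\rho)}{1-\rho}$. *)

theory Defs
  imports "HOL-Probability.Probability"
begin

definition gauss_on :: "'i set \<Rightarrow> ('i \<Rightarrow> real) measure" where
  "gauss_on I = PiM I (\<lambda>_. density lborel std_normal_density)"

definition gauss :: "nat \<Rightarrow> (nat \<Rightarrow> real) measure" where
  "gauss n = gauss_on {..<n}"

(* rho-correlated partner: y = rho x + sqrt(1-rho^2) z, with x, z independent standard Gaussians *)
definition corr_partner :: "nat \<Rightarrow> real \<Rightarrow> (nat \<Rightarrow> real) \<Rightarrow> (nat \<Rightarrow> real) \<Rightarrow> (nat \<Rightarrow> real)" where
  "corr_partner n \<rho> x z = (\<lambda>i\<in>{..<n}. \<rho> * x i + sqrt (1 - \<rho>\<^sup>2) * z i)"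

definition Stab :: "nat \<Rightarrow> real \<Rightarrow> ((nat \<Rightarrow> real) \<Rightarrow> real^3) \<Rightarrow> real" where
  "Stab n \<rho> f = (\<integral>p. inner (f (fst p)) (f (corr_partner n \<rho> (fst p) (snd p))) \<partial>(gauss n \<Otimes>\<^sub>M gauss n))"

definition f_opt3 :: "(nat \<Rightarrow> real) \<Rightarrow> real^3" where
  "f_opt3 x = (let p = (vector [x 0, x 1, x 2] :: real^3) in (1 / norm p) *\<^sub>R p)"

definition H3 :: bool where
  "H3 \<longleftrightarrow> (\<forall>n\<ge>3. \<forall>\<rho>\<in>{-1..0}. \<forall>f :: (nat \<Rightarrow> real) \<Rightarrow> real^3.
      f \<in> borel_measurable (gauss n) \<and> (\<forall>x\<in>space (gauss n). norm (f x) \<le> 1)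
      \<longrightarrow> Stab n \<rho> f \<ge> Stab n \<rho> f_opt3)"

(* A weighted graph: vertex set {..<N}; the (undirected) edge {i,j}, i<j<N, has weight w i j >= 0;
   weights sum to 1 (pairs of weight 0 are non-edges). *)
definition weighted_graph :: "nat \<Rightarrow> (nat \<Rightarrow> nat \<Rightarrow> real) \<Rightarrow> bool" where
  "weighted_graph N w \<longleftrightarrow> (\<forall>i j. i < j \<and> j < N \<longrightarrow> w i j \<ge> 0)
      \<and> (\<Sum>j<N. \<Sum>i<j. w i j) = 1"

definition edge_obj :: "nat \<Rightarrow> (nat \<Rightarrow> nat \<Rightarrow> real) \<Rightarrow> (nat \<Rightarrow> nat \<Rightarrow> real) \<Rightarrow> real" where
  "edge_obj N w ip = (\<Sum>j<N. \<Sum>i<j. w i j * (1/4 - 1/4 * ip i j))"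

definition ProdG :: "nat \<Rightarrow> (nat \<Rightarrow> nat \<Rightarrow> real) \<Rightarrow> real" where
  "ProdG N w = (SUP f \<in> {f :: nat \<Rightarrow> real^3. \<forall>i<N. f i \<in> sphere 0 1}.
                  edge_obj N w (\<lambda>i j. inner (f i) (f j)))"

definition SDP_Prod :: "nat \<Rightarrow> (nat \<Rightarrow> nat \<Rightarrow> real) \<Rightarrow> real" where
  "SDP_Prod N w = (SUP f \<in> {f :: nat \<Rightarrow> nat \<Rightarrow> real. \<forall>i<N. (\<Sum>k<N. (f i k)\<^sup>2) = 1}.
                  edge_obj N w (\<lambda>i j. \<Sum>k<N. f i k * f j k))"

(* F*(k,rho) = E < Zu/||Zu||, Zv/||Zv|| >, with m = 2, u = (1,0), v = (rho, sqrt(1-rho^2)),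
   Z a k x 2 standard Gaussian matrix (entries indexed by {..<k} x {..<2}). *)
definition Fstar :: "nat \<Rightarrow> real \<Rightarrow> real" where
  "Fstar k \<rho> =
    (let u = (\<lambda>j::nat. if j = 0 then 1 else 0);
         v = (\<lambda>j::nat. if j = 0 then \<rho> else sqrt (1 - \<rho>\<^sup>2));
         mulv = (\<lambda>Z a (i::nat). \<Sum>j<2. Z (i, j) * a j);
         nrm = (\<lambda>y. sqrt (\<Sum>i<k. (y i)\<^sup>2))
     in \<integral>Z. (\<Sum>i<k. (mulv Z u i / nrm (mulv Z u)) * (mulv Z v i / nrm (mulv Z v)))
          \<partial>(gauss_on ({..<k} \<times> {..<2})))"

definition alpha_BOV :: real where
  "alpha_BOV = (INF \<rho> \<in> {-1..<1}. (1 - Fstar 3 \<rho>) / (1 - \<rho>))"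

end

theory Submission
  imports Defs "HOL-Real_Asymp.Real_Asymp"
begin

text \<open>
  Write \<open>F\<close> for \<open>F*(3, .)\<close>. The law of \<open>(Zu, Zv)\<close> for a Gaussian matrix \<open>Z\<close> depends on the unit
  vectors \<open>u\<close> and \<open>v\<close> only through their inner product, so rounding each SDP vector \<open>u\<close> to \<open>Zu / |Zu|\<close>
  has expected value \<open>(1 - F) / 4\<close> on each edge; this gives \<open>Prod \<ge> \<alpha> SDP\<close>.

  Conversely, for \<open>\<rho> \<le> 0\<close> discretise the graph on the unit sphere of \<open>n\<close>-dimensional space whose
  edges are the directions of \<open>\<rho>\<close>-correlated Gaussian pairs. The identity embedding is an SDP solution
  of value about \<open>(1 - \<rho>) / 4\<close> by concentration of the norm, while the hypothesis bounds every
  3-dimensional solution by \<open>(1 - F(\<rho>)) / 4\<close>.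

  For \<open>\<rho> > 0\<close> the ratio \<open>(1 - F(\<rho>)) / (1 - \<rho>)\<close> is at least its value 1 at \<open>\<rho> = 0\<close>, that is, \<open>F(\<rho>) \<le> \<rho>\<close>.
  Indeed, rounding a hub and \<open>m\<close> spokes, where the hub has inner product \<open>r\<close> with each spoke and the
  spokes have pairwise inner product \<open>q\<close>, gives \<open>m F(r)\<^sup>2 \<le> 1 + (m - 1) F(q)\<close> by Cauchy-Schwarz. Taking
  \<open>q = 0\<close> yields \<open>F(r) \<le> 2r\<close>, and \<open>q = r\<^sup>2\<close>, \<open>m \<rightarrow> \<infinity>\<close> yields \<open>F(r)\<^sup>2 \<le> F(r\<^sup>2)\<close>; iterating the latter
  improves the factor 2 to 1.
\<close>

section \<open>Gaussian vectors and their linear images\<close>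

abbreviation dot :: "'i set \<Rightarrow> ('i \<Rightarrow> real) \<Rightarrow> ('i \<Rightarrow> real) \<Rightarrow> real" where
  "dot I a b \<equiv> (\<Sum>i\<in>I. a i * b i)"

abbreviation sq_norm :: "'i set \<Rightarrow> ('i \<Rightarrow> real) \<Rightarrow> real" where
  "sq_norm I a \<equiv> (\<Sum>i\<in>I. (a i)\<^sup>2)"

abbreviation sq_dist :: "'i set \<Rightarrow> ('i \<Rightarrow> real) \<Rightarrow> ('i \<Rightarrow> real) \<Rightarrow> real" where
  "sq_dist I a b \<equiv> (\<Sum>i\<in>I. (a i - b i)\<^sup>2)"

abbreviation std_normal :: "real measure" where
  "std_normal \<equiv> density lborel std_normal_density"

interpretation std_normal: prob_space std_normal
  by (rule prob_space_normal_density) simp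

interpretation std_normal_pair: pair_prob_space std_normal std_normal ..

interpretation std_normal_product: product_prob_space "\<lambda>_. std_normal" I for I :: "'i set"
  ..

interpretation gauss_on: prob_space "gauss_on I" for I :: "'i set"
  unfolding gauss_on_def by (intro prob_space_PiM std_normal.prob_space_axioms)

lemma sets_gauss_on [measurable_cong]: "sets (gauss_on I) = sets (PiM I (\<lambda>_. borel))"
  unfolding gauss_on_def by (intro sets_PiM_cong) simp_all

lemma nn_integral_lborel_shear_fst:
  fixes h :: "real \<times> real \<Rightarrow> ennreal"
  assumes [measurable]: "h \<in> borel_measurable (borel \<Otimes>\<^sub>M borel)"
  shows "(\<integral>\<^sup>+p. h (fst p + t * snd p, snd p) \<partial>(lborel \<Otimes>\<^sub>M lborel)) = (\<integral>\<^sup>+p. h p \<partial>(lborel \<Otimes>\<^sub>M lborel))"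
proof -
  have "(\<integral>\<^sup>+x. h (x + t * y, y) \<partial>lborel) = (\<integral>\<^sup>+x. h (x, y) \<partial>lborel)" for y
    using nn_integral_real_affine[of "\<lambda>x. h (x, y)" 1 "t * y"] by (simp add: add.commute)
  then show ?thesis
    by (simp add: lborel_pair.nn_integral_snd[symmetric])
qed

lemma nn_integral_lborel_shear_snd:
  fixes h :: "real \<times> real \<Rightarrow> ennreal"
  assumes [measurable]: "h \<in> borel_measurable (borel \<Otimes>\<^sub>M borel)"
  shows "(\<integral>\<^sup>+p. h (fst p, snd p + t * fst p) \<partial>(lborel \<Otimes>\<^sub>M lborel)) = (\<integral>\<^sup>+p. h p \<partial>(lborel \<Otimes>\<^sub>M lborel))"
proof -
  have "(\<integral>\<^sup>+y. h (x, y + t * x) \<partial>lborel) = (\<integral>\<^sup>+y. h (x, y) \<partial>lborel)" for x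
    using nn_integral_real_affine[of "\<lambda>y. h (x, y)" 1 "t * x"] by (simp add: add.commute)
  then show ?thesis
    by (simp add: lborel.nn_integral_fst[symmetric])
qed

text \<open>A plane rotation by an angle other than \<open>\<pi>\<close> is a product of three shears.\<close>
lemma nn_integral_lborel_rotate:
  fixes h :: "real \<times> real \<Rightarrow> ennreal"
  assumes [measurable]: "h \<in> borel_measurable (borel \<Otimes>\<^sub>M borel)"
    and cs: "c\<^sup>2 + s\<^sup>2 = 1" "c \<noteq> -1"
  shows "(\<integral>\<^sup>+p. h (c * fst p - s * snd p, s * fst p + c * snd p) \<partial>(lborel \<Otimes>\<^sub>M lborel))
    = (\<integral>\<^sup>+p. h p \<partial>(lborel \<Otimes>\<^sub>M lborel))"
proof -
  define t where "t = s / (1 + c)"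
  have t: "t * (1 + c) = s"
    using cs(2) by (simp add: t_def add_eq_0_iff)
  have "(1 - t * s - c) * (1 + c) = 1 - c\<^sup>2 - (t * (1 + c)) * s"
    by (simp add: algebra_simps power2_eq_square)
  also have "\<dots> = 0"
    using cs(1) by (simp add: t power2_eq_square)
  finally have c_eq: "c = 1 - t * s"
    using cs(2) by (simp add: add_eq_0_iff)
  have s_eq: "s = t * (2 - t * s)"
    using t by (simp add: c_eq)
  have "(\<integral>\<^sup>+p. h p \<partial>(lborel \<Otimes>\<^sub>M lborel)) = (\<integral>\<^sup>+p. h (fst p - t * snd p, snd p) \<partial>(lborel \<Otimes>\<^sub>M lborel))"
    using nn_integral_lborel_shear_fst[of h "- t"] by simp
  also have "\<dots> = (\<integral>\<^sup>+p. h (fst p - t * (snd p + s * fst p), snd p + s * fst p) \<partial>(lborel \<Otimes>\<^sub>M lborel))"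
    using nn_integral_lborel_shear_snd[of "\<lambda>p. h (fst p - t * snd p, snd p)" s] by simp
  also have "\<dots> = (\<integral>\<^sup>+p. h (fst p - t * snd p - t * (snd p + s * (fst p - t * snd p)),
      snd p + s * (fst p - t * snd p)) \<partial>(lborel \<Otimes>\<^sub>M lborel))"
    using nn_integral_lborel_shear_fst[of
        "\<lambda>p. h (fst p - t * (snd p + s * fst p), snd p + s * fst p)" "- t"]
    by simp
  also have "\<dots> = (\<integral>\<^sup>+p. h (c * fst p - s * snd p, s * fst p + c * snd p) \<partial>(lborel \<Otimes>\<^sub>M lborel))"
  proof (intro nn_integral_cong arg_cong[where f = h] prod_eqI; unfold fst_conv snd_conv)
    fix p :: "real \<times> real"
    have "fst p - t * snd p - t * (snd p + s * (fst p - t * snd p))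
        = (1 - t * s) * fst p - t * (2 - t * s) * snd p"
      by (simp add: algebra_simps)
    then show "fst p - t * snd p - t * (snd p + s * (fst p - t * snd p)) = c * fst p - s * snd p"
      by (simp only: flip: c_eq s_eq)
    show "snd p + s * (fst p - t * snd p) = s * fst p + c * snd p"
      by (simp add: c_eq algebra_simps)
  qed
  finally show ?thesis ..
qed

lemma std_normal_pair_eq_density:
  "std_normal \<Otimes>\<^sub>M std_normal
    = density (lborel \<Otimes>\<^sub>M lborel) (\<lambda>p. ennreal (exp (- ((fst p)\<^sup>2 + (snd p)\<^sup>2) / 2) / (2 * pi)))"
proof -
  have "std_normal \<Otimes>\<^sub>M std_normal = density (lborel \<Otimes>\<^sub>M lborel)
      (\<lambda>(x, y). ennreal (std_normal_density x) * ennreal (std_normal_density y))"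
    by (intro pair_measure_density std_normal.sigma_finite_measure_axioms)
       (auto intro: lborel.sigma_finite_measure_axioms)
  also have "(\<lambda>(x, y). ennreal (std_normal_density x) * ennreal (std_normal_density y))
      = (\<lambda>p. ennreal (exp (- ((fst p)\<^sup>2 + (snd p)\<^sup>2) / 2) / (2 * pi)))"
    by (simp add: fun_eq_iff std_normal_density_def add_divide_distrib diff_divide_distrib
        flip: ennreal_mult exp_add)
  finally show ?thesis .
qed

lemma nn_integral_std_normal_rotate:
  fixes h :: "real \<times> real \<Rightarrow> ennreal"
  assumes [measurable]: "h \<in> borel_measurable (borel \<Otimes>\<^sub>M borel)"
    and cs: "c\<^sup>2 + s\<^sup>2 = 1"
  shows "(\<integral>\<^sup>+p. h (c * fst p - s * snd p, s * fst p + c * snd p) \<partial>(std_normal \<Otimes>\<^sub>M std_normal))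
    = (\<integral>\<^sup>+p. h p \<partial>(std_normal \<Otimes>\<^sub>M std_normal))"
proof -
  have rotate: "(\<integral>\<^sup>+p. g (c * fst p - s * snd p, s * fst p + c * snd p) \<partial>(std_normal \<Otimes>\<^sub>M std_normal))
      = (\<integral>\<^sup>+p. g p \<partial>(std_normal \<Otimes>\<^sub>M std_normal))"
    if [measurable]: "g \<in> borel_measurable (borel \<Otimes>\<^sub>M borel)" and "c\<^sup>2 + s\<^sup>2 = 1" "c \<noteq> -1"
    for c s :: real and g :: "real \<times> real \<Rightarrow> ennreal"
  proof -
    let ?f = "\<lambda>p. ennreal (exp (- ((fst p)\<^sup>2 + (snd p)\<^sup>2) / 2) / (2 * pi)) * g p"
    have "(c * x - s * y)\<^sup>2 + (s * x + c * y)\<^sup>2 = x\<^sup>2 + y\<^sup>2" for x y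
    proof -
      have "(c * x - s * y)\<^sup>2 + (s * x + c * y)\<^sup>2 = (c\<^sup>2 + s\<^sup>2) * x\<^sup>2 + (c\<^sup>2 + s\<^sup>2) * y\<^sup>2"
        by (simp add: algebra_simps power2_eq_square)
      then show ?thesis by (simp add: that)
    qed
    then show ?thesis
      using nn_integral_lborel_rotate[of ?f c s] that
      by (simp add: std_normal_pair_eq_density nn_integral_density)
  qed
  show ?thesis
  proof (cases "c = -1")
    case True
    then have "s = 0" using cs by simp
    then show ?thesis
      using rotate[of h 0 1] rotate[of "\<lambda>p. h (- snd p, fst p)" 0 1] True by simp
  qed (rule rotate[OF assms])
qed

lemma rotation_to_axis:
  fixes \<alpha> a :: real
  obtains c s where "c\<^sup>2 + s\<^sup>2 = 1" "\<alpha> * c + a * s = sqrt (\<alpha>\<^sup>2 + a\<^sup>2)" "a * c = \<alpha> * s"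
proof (cases "\<alpha>\<^sup>2 + a\<^sup>2 = 0")
  case True
  then have "\<alpha> = 0" "a = 0" by (simp_all add: sum_power2_eq_zero_iff)
  then show ?thesis using that[of 1 0] by simp
next
  case False
  define r where "r = sqrt (\<alpha>\<^sup>2 + a\<^sup>2)"
  have r: "r > 0" "r * r = \<alpha>\<^sup>2 + a\<^sup>2"
    using False by (auto simp: r_def less_le)
  show ?thesis
  proof (rule that[of "\<alpha> / r" "a / r"])
    show "(\<alpha> / r)\<^sup>2 + (a / r)\<^sup>2 = 1"
      using r False by (simp add: power_divide power2_eq_square[of r] flip: add_divide_distrib)
    show "\<alpha> * (\<alpha> / r) + a * (a / r) = sqrt (\<alpha>\<^sup>2 + a\<^sup>2)"
      unfolding r_def[symmetric]
      using r by (simp add: divide_eq_eq power2_eq_square flip: add_divide_distrib)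
  qed simp
qed

lemma nn_integral_std_normal_add:
  fixes h :: "real \<Rightarrow> ennreal"
  assumes [measurable]: "h \<in> borel_measurable borel"
  shows "(\<integral>\<^sup>+p. h (\<gamma> * fst p + \<delta> * snd p) \<partial>(std_normal \<Otimes>\<^sub>M std_normal))
    = (\<integral>\<^sup>+y. h (sqrt (\<gamma>\<^sup>2 + \<delta>\<^sup>2) * y) \<partial>std_normal)"
proof -
  obtain c s where cs: "c\<^sup>2 + s\<^sup>2 = 1" "\<gamma> * c + \<delta> * s = sqrt (\<gamma>\<^sup>2 + \<delta>\<^sup>2)" "\<delta> * c = \<gamma> * s"
    using rotation_to_axis .
  have "(\<integral>\<^sup>+p. h (\<gamma> * fst p + \<delta> * snd p) \<partial>(std_normal \<Otimes>\<^sub>M std_normal))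
      = (\<integral>\<^sup>+p. h (\<gamma> * (c * fst p - s * snd p) + \<delta> * (s * fst p + c * snd p))
          \<partial>(std_normal \<Otimes>\<^sub>M std_normal))"
    using nn_integral_std_normal_rotate[of "\<lambda>p. h (\<gamma> * fst p + \<delta> * snd p)" c s] cs(1) by simp
  also have "\<dots> = (\<integral>\<^sup>+p. h (sqrt (\<gamma>\<^sup>2 + \<delta>\<^sup>2) * fst p) \<partial>(std_normal \<Otimes>\<^sub>M std_normal))"
  proof (intro nn_integral_cong arg_cong[where f = h])
    fix p :: "real \<times> real"
    have "\<gamma> * (c * fst p - s * snd p) + \<delta> * (s * fst p + c * snd p)
        = (\<gamma> * c + \<delta> * s) * fst p + (\<delta> * c - \<gamma> * s) * snd p"
      by (simp add: algebra_simps)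
    then show "\<gamma> * (c * fst p - s * snd p) + \<delta> * (s * fst p + c * snd p) = sqrt (\<gamma>\<^sup>2 + \<delta>\<^sup>2) * fst p"
      by (simp add: cs(2,3))
  qed
  also have "\<dots> = (\<integral>\<^sup>+x. \<integral>\<^sup>+y. h (sqrt (\<gamma>\<^sup>2 + \<delta>\<^sup>2) * x) \<partial>std_normal \<partial>std_normal)"
    by (subst std_normal.nn_integral_fst[symmetric]) simp_all
  also have "\<dots> = (\<integral>\<^sup>+x. h (sqrt (\<gamma>\<^sup>2 + \<delta>\<^sup>2) * x) \<partial>std_normal)"
    using std_normal.emeasure_space_1 by simp
  finally show ?thesis .
qed

text \<open>The map is the Cholesky factor of the covariance matrix with rows \<open>(A, B)\<close> and \<open>(B, C)\<close>.
  If \<open>A = 0\<close>, semidefiniteness forces \<open>B = 0\<close>, in accordance with division by zero.\<close>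
definition bivariate_normal :: "real \<Rightarrow> real \<Rightarrow> real \<Rightarrow> (real \<times> real) measure" where
  "bivariate_normal A B C = distr (std_normal \<Otimes>\<^sub>M std_normal) (borel \<Otimes>\<^sub>M borel)
     (\<lambda>p. (sqrt A * fst p, B / sqrt A * fst p + sqrt (C - B\<^sup>2 / A) * snd p))"

lemma sets_bivariate_normal [measurable_cong]:
  "sets (bivariate_normal A B C) = sets (borel \<Otimes>\<^sub>M borel)"
  by (simp add: bivariate_normal_def)

lemma prob_space_bivariate_normal: "prob_space (bivariate_normal A B C)"
  unfolding bivariate_normal_def by (intro std_normal_pair.prob_space_distr) simp

lemma nn_integral_bivariate_normal:
  fixes h :: "real \<times> real \<Rightarrow> ennreal"
  assumes [measurable]: "h \<in> borel_measurable (borel \<Otimes>\<^sub>M borel)" and "\<alpha> \<ge> 0" "\<gamma> \<ge> 0"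
  shows "(\<integral>\<^sup>+p. h p \<partial>bivariate_normal (\<alpha>\<^sup>2) (\<alpha> * \<beta>) (\<beta>\<^sup>2 + \<gamma>\<^sup>2))
    = (\<integral>\<^sup>+p. h (\<alpha> * fst p, \<beta> * fst p + \<gamma> * snd p) \<partial>(std_normal \<Otimes>\<^sub>M std_normal))"
proof (cases "\<alpha> = 0")
  case True
  have "(\<integral>\<^sup>+p. h (0, sqrt (\<beta>\<^sup>2 + \<gamma>\<^sup>2) * snd p) \<partial>(std_normal \<Otimes>\<^sub>M std_normal))
      = (\<integral>\<^sup>+y. h (0, sqrt (\<beta>\<^sup>2 + \<gamma>\<^sup>2) * y) \<partial>std_normal)"
    using std_normal.emeasure_space_1
    by (subst std_normal_pair.nn_integral_snd[symmetric]) simp_all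
  also have "\<dots> = (\<integral>\<^sup>+p. h (0, \<beta> * fst p + \<gamma> * snd p) \<partial>(std_normal \<Otimes>\<^sub>M std_normal))"
    by (rule nn_integral_std_normal_add[symmetric]) simp
  finally show ?thesis
    using True by (simp add: bivariate_normal_def nn_integral_distr)
next
  case False
  then show ?thesis
    using assms(2,3) by (simp add: bivariate_normal_def nn_integral_distr power_mult_distrib)
qed

lemma nn_integral_std_normal_merge:
  fixes h :: "real \<times> real \<Rightarrow> ennreal"
  assumes [measurable]: "h \<in> borel_measurable (borel \<Otimes>\<^sub>M borel)"
  shows "(\<integral>\<^sup>+q. \<integral>\<^sup>+y. h (\<alpha> * fst q, \<beta> * fst q + (\<gamma> * y + \<delta> * snd q)) \<partial>std_normal
      \<partial>(std_normal \<Otimes>\<^sub>M std_normal))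
    = (\<integral>\<^sup>+p. h (\<alpha> * fst p, \<beta> * fst p + sqrt (\<gamma>\<^sup>2 + \<delta>\<^sup>2) * snd p) \<partial>(std_normal \<Otimes>\<^sub>M std_normal))"
    (is "?lhs = ?rhs")
proof -
  have "?lhs = (\<integral>\<^sup>+x. \<integral>\<^sup>+t. \<integral>\<^sup>+y. h (\<alpha> * x, \<beta> * x + (\<gamma> * y + \<delta> * t)) \<partial>std_normal
      \<partial>std_normal \<partial>std_normal)"
    by (simp add: std_normal.nn_integral_fst[symmetric])
  also have "\<dots> = (\<integral>\<^sup>+x. \<integral>\<^sup>+p. h (\<alpha> * x, \<beta> * x + (\<gamma> * fst p + \<delta> * snd p))
      \<partial>(std_normal \<Otimes>\<^sub>M std_normal) \<partial>std_normal)"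
    by (simp add: std_normal_pair.nn_integral_snd[symmetric])
  also have "\<dots> = (\<integral>\<^sup>+x. \<integral>\<^sup>+y. h (\<alpha> * x, \<beta> * x + sqrt (\<gamma>\<^sup>2 + \<delta>\<^sup>2) * y) \<partial>std_normal \<partial>std_normal)"
    by (simp add: nn_integral_std_normal_add[where h = "\<lambda>u. h (\<alpha> * x, \<beta> * x + u)" for x])
  also have "\<dots> = ?rhs"
    by (simp add: std_normal.nn_integral_fst[symmetric])
  finally show ?thesis .
qed

text \<open>A rotation of the first and third Gaussian variables removes the third one from the first argument
  of \<open>h\<close>; it is then merged with the second one.\<close>
lemma nn_integral_std_normal_eliminate:
  fixes h :: "real \<times> real \<Rightarrow> ennreal"
  assumes [measurable]: "h \<in> borel_measurable (borel \<Otimes>\<^sub>M borel)"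
    and cs: "c\<^sup>2 + s\<^sup>2 = 1" and ac: "a * c = \<alpha> * s"
  shows "(\<integral>\<^sup>+t. \<integral>\<^sup>+p. h (\<alpha> * fst p + a * t, \<beta> * fst p + \<gamma> * snd p + b * t)
      \<partial>(std_normal \<Otimes>\<^sub>M std_normal) \<partial>std_normal)
    = (\<integral>\<^sup>+p. h ((\<alpha> * c + a * s) * fst p,
        (\<beta> * c + b * s) * fst p + sqrt (\<gamma>\<^sup>2 + (b * c - \<beta> * s)\<^sup>2) * snd p)
      \<partial>(std_normal \<Otimes>\<^sub>M std_normal))"
proof -
  define r where "r = \<alpha> * c + a * s"
  define \<beta>' where "\<beta>' = \<beta> * c + b * s"
  define \<delta> where "\<delta> = b * c - \<beta> * s"
  let ?g = "\<lambda>q. \<integral>\<^sup>+y. h (\<alpha> * fst q + a * snd q, \<beta> * fst q + \<gamma> * y + b * snd q) \<partial>std_normal"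
  have "(\<integral>\<^sup>+t. \<integral>\<^sup>+p. h (\<alpha> * fst p + a * t, \<beta> * fst p + \<gamma> * snd p + b * t)
        \<partial>(std_normal \<Otimes>\<^sub>M std_normal) \<partial>std_normal)
      = (\<integral>\<^sup>+t. \<integral>\<^sup>+x. ?g (x, t) \<partial>std_normal \<partial>std_normal)"
    by (simp add: std_normal.nn_integral_fst[symmetric])
  also have "\<dots> = (\<integral>\<^sup>+q. ?g q \<partial>(std_normal \<Otimes>\<^sub>M std_normal))"
    by (subst std_normal_pair.nn_integral_snd[symmetric]) simp_all
  also have "\<dots> = (\<integral>\<^sup>+q. ?g (c * fst q - s * snd q, s * fst q + c * snd q) \<partial>(std_normal \<Otimes>\<^sub>M std_normal))"
    using cs by (intro nn_integral_std_normal_rotate[symmetric]) simp_all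
  also have "\<dots> = (\<integral>\<^sup>+q. \<integral>\<^sup>+y. h (r * fst q, \<beta>' * fst q + (\<gamma> * y + \<delta> * snd q)) \<partial>std_normal
      \<partial>(std_normal \<Otimes>\<^sub>M std_normal))"
  proof (intro nn_integral_cong arg_cong[where f = h] prod_eqI; unfold fst_conv snd_conv)
    fix q :: "real \<times> real" and y :: real
    have "\<alpha> * (c * fst q - s * snd q) + a * (s * fst q + c * snd q)
        = r * fst q + (a * c - \<alpha> * s) * snd q"
      by (simp add: r_def algebra_simps)
    then show "\<alpha> * (c * fst q - s * snd q) + a * (s * fst q + c * snd q) = r * fst q"
      by (simp add: ac)
    show "\<beta> * (c * fst q - s * snd q) + \<gamma> * y + b * (s * fst q + c * snd q)
        = \<beta>' * fst q + (\<gamma> * y + \<delta> * snd q)"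
      by (simp add: \<beta>'_def \<delta>_def algebra_simps)
  qed
  also have "\<dots> = (\<integral>\<^sup>+p. h (r * fst p, \<beta>' * fst p + sqrt (\<gamma>\<^sup>2 + \<delta>\<^sup>2) * snd p)
      \<partial>(std_normal \<Otimes>\<^sub>M std_normal))"
    by (rule nn_integral_std_normal_merge[OF assms(1)])
  finally show ?thesis
    by (simp only: r_def \<beta>'_def \<delta>_def)
qed

lemma nn_integral_bivariate_normal_add:
  fixes h :: "real \<times> real \<Rightarrow> ennreal"
  assumes [measurable]: "h \<in> borel_measurable (borel \<Otimes>\<^sub>M borel)" and nonneg: "\<alpha> \<ge> 0" "\<gamma> \<ge> 0"
  shows "(\<integral>\<^sup>+t. \<integral>\<^sup>+p. h (fst p + a * t, snd p + b * t)
      \<partial>bivariate_normal (\<alpha>\<^sup>2) (\<alpha> * \<beta>) (\<beta>\<^sup>2 + \<gamma>\<^sup>2) \<partial>std_normal)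
    = (\<integral>\<^sup>+p. h p \<partial>bivariate_normal (\<alpha>\<^sup>2 + a\<^sup>2) (\<alpha> * \<beta> + a * b) (\<beta>\<^sup>2 + \<gamma>\<^sup>2 + b\<^sup>2))"
proof -
  obtain c s where cs: "c\<^sup>2 + s\<^sup>2 = 1"
    and axis: "\<alpha> * c + a * s = sqrt (\<alpha>\<^sup>2 + a\<^sup>2)" and ac: "a * c = \<alpha> * s"
    using rotation_to_axis .
  define r where "r = \<alpha> * c + a * s"
  define \<beta>' where "\<beta>' = \<beta> * c + b * s"
  define \<gamma>' where "\<gamma>' = sqrt (\<gamma>\<^sup>2 + (b * c - \<beta> * s)\<^sup>2)"
  have r: "r \<ge> 0" "r\<^sup>2 = \<alpha>\<^sup>2 + a\<^sup>2"
    using axis by (simp_all add: r_def)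
  have "r * \<beta>' = (\<alpha> * \<beta> + a * b) * (c\<^sup>2 + s\<^sup>2) + (\<alpha> * s - a * c) * (b * c - \<beta> * s)"
    by (simp add: r_def \<beta>'_def algebra_simps power2_eq_square)
  then have r\<beta>': "r * \<beta>' = \<alpha> * \<beta> + a * b"
    by (simp add: cs ac)
  have "\<beta>'\<^sup>2 + (b * c - \<beta> * s)\<^sup>2 = (\<beta>\<^sup>2 + b\<^sup>2) * (c\<^sup>2 + s\<^sup>2)"
    by (simp add: \<beta>'_def algebra_simps power2_eq_square)
  then have \<beta>\<gamma>': "\<beta>'\<^sup>2 + \<gamma>'\<^sup>2 = \<beta>\<^sup>2 + \<gamma>\<^sup>2 + b\<^sup>2"
    by (simp add: \<gamma>'_def cs)
  have "(\<integral>\<^sup>+t. \<integral>\<^sup>+p. h (fst p + a * t, snd p + b * t)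
        \<partial>bivariate_normal (\<alpha>\<^sup>2) (\<alpha> * \<beta>) (\<beta>\<^sup>2 + \<gamma>\<^sup>2) \<partial>std_normal)
      = (\<integral>\<^sup>+p. h (r * fst p, \<beta>' * fst p + \<gamma>' * snd p) \<partial>(std_normal \<Otimes>\<^sub>M std_normal))"
    using nonneg nn_integral_std_normal_eliminate[OF assms(1) cs ac]
    by (simp add: nn_integral_bivariate_normal r_def \<beta>'_def \<gamma>'_def)
  also have "\<dots> = (\<integral>\<^sup>+p. h p \<partial>bivariate_normal (r\<^sup>2) (r * \<beta>') (\<beta>'\<^sup>2 + \<gamma>'\<^sup>2))"
    using r(1) by (intro nn_integral_bivariate_normal[symmetric]) (simp_all add: \<gamma>'_def)
  finally show ?thesis
    by (simp only: r r\<beta>' \<beta>\<gamma>')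
qed

lemma Cholesky_2x2:
  fixes A B C :: real
  assumes "A \<ge> 0" "C \<ge> 0" "B\<^sup>2 \<le> A * C"
  obtains \<alpha> \<gamma> \<beta> where "\<alpha> \<ge> 0" "\<gamma> \<ge> 0" "A = \<alpha>\<^sup>2" "B = \<alpha> * \<beta>" "C = \<beta>\<^sup>2 + \<gamma>\<^sup>2"
proof (cases "A = 0")
  case True
  then show ?thesis using assms that[of 0 "sqrt C" 0] by simp
next
  case False
  then have "B\<^sup>2 / A \<le> C"
    using assms by (simp add: divide_le_eq mult.commute)
  then show ?thesis
    using assms False
    by (intro that[of "sqrt A" "sqrt (C - B\<^sup>2 / A)" "B / sqrt A"]) (auto simp: power_divide)
qed

lemma dot_insert_upd:
  fixes z d :: "'j \<Rightarrow> real"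
  assumes "finite J" "k \<notin> J"
  shows "dot (insert k J) (z(k := t)) d = dot J z d + d k * t"
proof -
  have "dot J (z(k := t)) d = dot J z d"
    using assms by (intro sum.cong) auto
  then show ?thesis using assms by (simp add: mult.commute)
qed

lemma nn_integral_gauss_on_linear_pair:
  fixes h :: "real \<times> real \<Rightarrow> ennreal"
  assumes "finite J" "h \<in> borel_measurable (borel \<Otimes>\<^sub>M borel)"
  shows "(\<integral>\<^sup>+z. h (dot J z a, dot J z b) \<partial>gauss_on J)
    = (\<integral>\<^sup>+p. h p \<partial>bivariate_normal (sq_norm J a) (dot J a b) (sq_norm J b))"
  using assms
proof (induction J arbitrary: h)
  case empty
  then show ?case
    using std_normal_pair.emeasure_space_1
    by (simp add: gauss_on_def PiM_empty nn_integral_count_space_finite bivariate_normal_def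
        nn_integral_distr)
next
  case (insert k J)
  let ?A = "sq_norm J a" and ?B = "dot J a b" and ?C = "sq_norm J b"
  note [measurable] = insert.prems
  have "?A \<ge> 0" "?C \<ge> 0" by (simp_all add: sum_nonneg)
  then obtain \<alpha> \<gamma> \<beta> where Cholesky: "\<alpha> \<ge> 0" "\<gamma> \<ge> 0" "?A = \<alpha>\<^sup>2" "?B = \<alpha> * \<beta>" "?C = \<beta>\<^sup>2 + \<gamma>\<^sup>2"
    by (rule Cholesky_2x2[OF _ _ Cauchy_Schwarz_ineq_sum])
  have "(\<integral>\<^sup>+z. h (dot (insert k J) z a, dot (insert k J) z b) \<partial>gauss_on (insert k J))
      = (\<integral>\<^sup>+t. \<integral>\<^sup>+z. h (dot (insert k J) (z(k := t)) a, dot (insert k J) (z(k := t)) b)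
          \<partial>gauss_on J \<partial>std_normal)"
    unfolding gauss_on_def
    by (intro std_normal_product.product_nn_integral_insert_rev insert.hyps) simp
  also have "\<dots> = (\<integral>\<^sup>+t. \<integral>\<^sup>+z. h (dot J z a + a k * t, dot J z b + b k * t)
      \<partial>gauss_on J \<partial>std_normal)"
    by (simp only: dot_insert_upd[OF insert.hyps(1,2)])
  also have "\<dots> = (\<integral>\<^sup>+t. \<integral>\<^sup>+p. h (fst p + a k * t, snd p + b k * t)
      \<partial>bivariate_normal ?A ?B ?C \<partial>std_normal)"
    using insert.IH[of "\<lambda>p. h (fst p + a k * t, snd p + b k * t)" for t] by simp
  also have "\<dots> = (\<integral>\<^sup>+p. h p \<partial>bivariate_normal (?A + (a k)\<^sup>2) (?B + a k * b k) (?C + (b k)\<^sup>2))"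
    using Cholesky(1,2) insert.prems unfolding Cholesky(3-5) by (intro nn_integral_bivariate_normal_add)
  finally show ?case
    using insert.hyps by (simp add: add.commute)
qed

lemma distr_gauss_on_linear_pair:
  assumes "finite J"
  shows "distr (gauss_on J) (borel \<Otimes>\<^sub>M borel) (\<lambda>z. (dot J z a, dot J z b))
    = bivariate_normal (sq_norm J a) (dot J a b) (sq_norm J b)"
    (is "?D = ?N")
proof (rule measure_eqI)
  fix E assume "E \<in> sets ?D"
  then have E: "E \<in> sets (borel \<Otimes>\<^sub>M borel)" by simp
  have "emeasure ?D E = (\<integral>\<^sup>+p. indicator E p \<partial>?D)"
    using E by simp
  also have "\<dots> = (\<integral>\<^sup>+z. indicator E (dot J z a, dot J z b) \<partial>gauss_on J)"
    using E by (intro nn_integral_distr) simp_all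
  also have "\<dots> = emeasure ?N E"
    using E assms by (simp add: nn_integral_gauss_on_linear_pair sets_bivariate_normal)
  finally show "emeasure ?D E = emeasure ?N E" .
qed (simp add: sets_bivariate_normal)

definition mat_vec :: "'i set \<Rightarrow> 'j set \<Rightarrow> ('i \<times> 'j \<Rightarrow> real) \<Rightarrow> ('j \<Rightarrow> real) \<Rightarrow> 'i \<Rightarrow> real" where
  "mat_vec I J Z a = (\<lambda>i\<in>I. \<Sum>j\<in>J. Z (i, j) * a j)"

lemma measurable_mat_vec [measurable]:
  "(\<lambda>Z. mat_vec I J Z a) \<in> gauss_on (I \<times> J) \<rightarrow>\<^sub>M gauss_on I"
  unfolding mat_vec_def by measurable

lemma measurable_mat_vec_component [measurable]:
  "i \<in> I \<Longrightarrow> (\<lambda>Z. mat_vec I J Z a i) \<in> borel_measurable (gauss_on (I \<times> J))"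
  unfolding mat_vec_def by simp

lemma indep_vars_gauss_on:
  assumes "finite I"
  shows "prob_space.indep_vars (gauss_on I) (\<lambda>_. std_normal) (\<lambda>i z. z i) I"
proof (cases "I = {}")
  case True
  then show ?thesis
    by (simp add: gauss_on.indep_vars_def gauss_on.indep_sets_def)
next
  case False
  have "distr (gauss_on I) (PiM I (\<lambda>_. std_normal)) (\<lambda>z. \<lambda>i\<in>I. z i) = PiM I (\<lambda>_. std_normal)"
    unfolding gauss_on_def
    using assms std_normal_product.distr_PiM_restrict_finite[of I I] by simp
  also have "\<dots> = PiM I (\<lambda>i. distr (gauss_on I) std_normal (\<lambda>z. z i))"
    unfolding gauss_on_def
    by (intro PiM_cong refl distr_PiM_component[symmetric] std_normal.prob_space_axioms)
  finally show ?thesis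
    using False by (subst gauss_on.indep_vars_iff_distr_eq_PiM') (simp_all add: gauss_on_def)
qed

lemma distr_mat_vec_pair:
  assumes I: "finite I" "I \<noteq> {}" and J: "finite J"
  shows "distr (gauss_on (I \<times> J)) (PiM I (\<lambda>_. borel \<Otimes>\<^sub>M borel))
      (\<lambda>Z. \<lambda>i\<in>I. (mat_vec I J Z a i, mat_vec I J Z b i))
    = PiM I (\<lambda>_. bivariate_normal (sq_norm J a) (dot J a b) (sq_norm J b))"
    (is "distr ?G ?B (\<lambda>Z. \<lambda>i\<in>I. ?row i Z) = PiM I (\<lambda>_. ?N)")
proof -
  let ?R = "\<lambda>i z. (\<Sum>k\<in>{i} \<times> J. z k * a (snd k), \<Sum>k\<in>{i} \<times> J. z k * b (snd k))"
  have "prob_space.indep_vars ?G (\<lambda>i. PiM ({i} \<times> J) (\<lambda>_. std_normal)) (\<lambda>i Z. restrict Z ({i} \<times> J)) I"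
    by (rule gauss_on.indep_vars_restrict[OF indep_vars_gauss_on])
       (use I J in \<open>auto simp: disjoint_family_on_def\<close>)
  then have "prob_space.indep_vars ?G (\<lambda>_. borel \<Otimes>\<^sub>M borel) (\<lambda>i Z. ?R i (restrict Z ({i} \<times> J))) I"
    by (rule gauss_on.indep_vars_compose2) (unfold gauss_on_def[symmetric], measurable)
  also have "?this \<longleftrightarrow> prob_space.indep_vars ?G (\<lambda>_. borel \<Otimes>\<^sub>M borel) ?row I"
    by (intro gauss_on.indep_vars_cong refl ext) (simp add: mat_vec_def sum.cartesian_product')
  finally have indep: "prob_space.indep_vars ?G (\<lambda>_. borel \<Otimes>\<^sub>M borel) ?row I" .
  have law: "distr ?G (borel \<Otimes>\<^sub>M borel) (?row i) = ?N" if i: "i \<in> I" for i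
  proof -
    define row :: "('b \<Rightarrow> real) \<Rightarrow> 'a \<times> 'b \<Rightarrow> real"
      where "row c k = (if fst k = i then c (snd k) else 0)" for c k
    have "(\<Sum>l\<in>I. \<Sum>j\<in>J. if l = i then g l j else 0) = (\<Sum>j\<in>J. g i j)" for g :: "'a \<Rightarrow> 'b \<Rightarrow> real"
      using i I by (subst sum.swap) simp
    then have "dot (I \<times> J) Z (row c) = mat_vec I J Z c i"
      "dot (I \<times> J) (row c) (row d) = dot J c d" for Z c d
      using i by (simp_all add: row_def mat_vec_def sum.cartesian_product'
          if_distrib[of "\<lambda>x. _ * x"] if_distrib[of "\<lambda>x. x * _"] cong: if_cong)
    then show ?thesis
      using distr_gauss_on_linear_pair[of "I \<times> J" "row a" "row b"] I J by (simp add: power2_eq_square)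
  qed
  have "distr ?G ?B (\<lambda>Z. \<lambda>i\<in>I. ?row i Z) = PiM I (\<lambda>i. distr ?G (borel \<Otimes>\<^sub>M borel) (?row i))"
    using indep I
    by (subst (asm) gauss_on.indep_vars_iff_distr_eq_PiM') (auto simp: gauss_on.indep_vars_def)
  also have "\<dots> = PiM I (\<lambda>_. ?N)"
    by (intro PiM_cong refl law)
  finally show ?thesis .
qed

lemma distr_gauss_on_columns:
  assumes "finite I" "finite J" "j \<in> J" "k \<in> J" "j \<noteq> k"
  shows "distr (gauss_on (I \<times> J)) (gauss_on I \<Otimes>\<^sub>M gauss_on I) (\<lambda>Z. (\<lambda>i\<in>I. Z (i, j), \<lambda>i\<in>I. Z (i, k)))
    = gauss_on I \<Otimes>\<^sub>M gauss_on I"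
proof -
  let ?G = "gauss_on (I \<times> J)"
  let ?col = "\<lambda>l Z. \<lambda>i\<in>I. Z (i, l)"
  have col: "?col l \<in> PiM (I \<times> {l}) (\<lambda>_. std_normal) \<rightarrow>\<^sub>M gauss_on I" for l
    unfolding gauss_on_def by (intro measurable_restrict measurable_component_singleton) simp
  have "prob_space.indep_var ?G (PiM (I \<times> {j}) (\<lambda>_. std_normal)) (\<lambda>Z. restrict Z (I \<times> {j}))
      (PiM (I \<times> {k}) (\<lambda>_. std_normal)) (\<lambda>Z. restrict Z (I \<times> {k}))"
    by (rule gauss_on.indep_var_restrict[OF indep_vars_gauss_on]) (use assms in auto)
  from gauss_on.indep_var_compose[OF this col col]
  have "prob_space.indep_var ?G (gauss_on I) (?col j) (gauss_on I) (?col k)"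
    by (simp add: comp_def cong: restrict_cong)
  then have "distr ?G (gauss_on I \<Otimes>\<^sub>M gauss_on I) (\<lambda>Z. (?col j Z, ?col k Z))
      = distr ?G (gauss_on I) (?col j) \<Otimes>\<^sub>M distr ?G (gauss_on I) (?col k)"
    by (simp add: gauss_on.indep_var_distribution_eq)
  moreover have "distr ?G (gauss_on I) (?col l) = gauss_on I" if "l \<in> J" for l
    unfolding gauss_on_def using that
    by (intro distr_PiM_reindex[of "I \<times> J" "\<lambda>_. std_normal"] std_normal.prob_space_axioms)
       (auto intro: inj_onI)
  ultimately show ?thesis
    using assms by simp
qed

lemma distr_mat_vec:
  assumes "finite I" "I \<noteq> {}" "finite J" and a: "sq_norm J a = 1"
  shows "distr (gauss_on (I \<times> J)) (gauss_on I) (\<lambda>Z. mat_vec I J Z a) = gauss_on I"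
proof -
  let ?N = "bivariate_normal 1 1 1"
  have [measurable]: "compose I fst \<in> PiM I (\<lambda>_. borel \<Otimes>\<^sub>M borel) \<rightarrow>\<^sub>M gauss_on I"
    unfolding compose_def[abs_def] by measurable
  have "distr (gauss_on (I \<times> J)) (gauss_on I) (\<lambda>Z. mat_vec I J Z a)
      = distr (gauss_on (I \<times> J)) (gauss_on I)
          (compose I fst \<circ> (\<lambda>Z. \<lambda>i\<in>I. (mat_vec I J Z a i, mat_vec I J Z a i)))"
    by (intro distr_cong refl) (auto simp: compose_def mat_vec_def)
  also have "\<dots> = distr (PiM I (\<lambda>_. ?N)) (gauss_on I) (compose I fst)"
    using distr_mat_vec_pair[OF assms(1-3), of a a] a
    by (subst distr_distr[where N = "PiM I (\<lambda>_. borel \<Otimes>\<^sub>M borel)", symmetric])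
       (simp_all add: power2_eq_square compose_def)
  also have "\<dots> = PiM I (\<lambda>_. distr ?N std_normal fst)"
    unfolding gauss_on_def using assms
    by (intro distr_PiM_finite_prob_space' prob_space_bivariate_normal std_normal.prob_space_axioms)
       simp_all
  also have "distr ?N std_normal fst = std_normal"
    using std_normal.distr_pair_fst[of std_normal]
    unfolding bivariate_normal_def by (subst distr_distr) (simp_all add: comp_def)
  finally show ?thesis by (simp add: gauss_on_def)
qed

section \<open>The function F*(k, .)\<close>

definition direction :: "'i set \<Rightarrow> ('i \<Rightarrow> real) \<Rightarrow> 'i \<Rightarrow> real" where
  "direction I x i = x i / sqrt (sq_norm I x)"

lemma sq_norm_direction: "sq_norm I (direction I x) = (if sq_norm I x = 0 then 0 else 1)"
  by (simp add: direction_def power_divide sum_nonneg flip: sum_divide_distrib)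

lemma sq_norm_direction_le_1: "sq_norm I (direction I x) \<le> 1"
  by (simp add: sq_norm_direction)

lemma abs_dot_le_1:
  assumes "sq_norm I x \<le> 1" "sq_norm I y \<le> 1"
  shows "\<bar>dot I x y\<bar> \<le> 1"
proof -
  have "(dot I x y)\<^sup>2 \<le> sq_norm I x * sq_norm I y"
    by (rule Cauchy_Schwarz_ineq_sum)
  also have "\<dots> \<le> 1 * 1"
    using assms by (intro mult_mono) (auto intro: sum_nonneg)
  finally show ?thesis by (simp add: abs_square_le_1)
qed

definition gauss_round :: "nat \<Rightarrow> 'j set \<Rightarrow> ('j \<Rightarrow> real) \<Rightarrow> (nat \<times> 'j \<Rightarrow> real) \<Rightarrow> nat \<Rightarrow> real" where
  "gauss_round k J a Z = direction {..<k} (mat_vec {..<k} J Z a)"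

lemma measurable_gauss_round [measurable]:
  "i < k \<Longrightarrow> (\<lambda>Z. gauss_round k J a Z i) \<in> borel_measurable (gauss_on ({..<k} \<times> J))"
  unfolding gauss_round_def direction_def by measurable

lemma sq_norm_gauss_round_le_1: "sq_norm {..<k} (gauss_round k J a Z) \<le> 1"
  unfolding gauss_round_def by (rule sq_norm_direction_le_1)

lemma gauss_round_uminus: "gauss_round k J (\<lambda>j. - a j) Z i = - gauss_round k J a Z i" if "i < k"
  using that by (simp add: gauss_round_def direction_def mat_vec_def sum_negf)

lemma abs_dot_gauss_round_le_1: "\<bar>dot {..<k} (gauss_round k J a Z) (gauss_round k J b Z)\<bar> \<le> 1"
  by (intro abs_dot_le_1 sq_norm_gauss_round_le_1)

lemma integrable_dot_gauss_round:
  "integrable (gauss_on ({..<k} \<times> J)) (\<lambda>Z. dot {..<k} (gauss_round k J a Z) (gauss_round k J b Z))"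
  by (rule gauss_on.integrable_const_bound[of _ 1]) (simp_all add: abs_dot_gauss_round_le_1)

definition planar_unit :: "real \<Rightarrow> nat \<Rightarrow> real" where
  "planar_unit \<rho> j = (if j = 0 then \<rho> else sqrt (1 - \<rho>\<^sup>2))"

lemma sq_norm_planar_unit:
  assumes "\<bar>\<rho>\<bar> \<le> 1"
  shows "sq_norm {..<2} (planar_unit \<rho>) = 1"
proof -
  have "\<rho>\<^sup>2 \<le> 1" using assms by (simp add: abs_square_le_1)
  then show ?thesis by (simp add: planar_unit_def numeral_2_eq_2)
qed

lemma dot_planar_unit: "dot {..<2} (planar_unit 1) (planar_unit \<rho>) = \<rho>"
  by (simp add: planar_unit_def numeral_2_eq_2)

lemma mat_vec_planar_unit:
  "mat_vec I {..<2} Z (planar_unit \<rho>) = (\<lambda>i\<in>I. \<rho> * Z (i, 0) + sqrt (1 - \<rho>\<^sup>2) * Z (i, 1))"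
  by (simp add: mat_vec_def planar_unit_def numeral_2_eq_2 mult.commute cong: restrict_cong)

lemma Fstar_planar_unit:
  "Fstar k \<rho> = (\<integral>Z. dot {..<k} (gauss_round k {..<2} (planar_unit 1) Z)
      (gauss_round k {..<2} (planar_unit \<rho>) Z) \<partial>gauss_on ({..<k} \<times> {..<2}))"
  unfolding Fstar_def Let_def
  by (intro Bochner_Integration.integral_cong refl sum.cong)
     (simp add: gauss_round_def direction_def mat_vec_def planar_unit_def numeral_2_eq_2)

lemma integral_dot_gauss_round_eq_bivariate:
  assumes "k > 0" "finite J" "sq_norm J a = 1" "sq_norm J b = 1"
  shows "(\<integral>Z. dot {..<k} (gauss_round k J a Z) (gauss_round k J b Z) \<partial>gauss_on ({..<k} \<times> J))
    = (\<integral>p. dot {..<k} (direction {..<k} (fst \<circ> p)) (direction {..<k} (snd \<circ> p))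
        \<partial>PiM {..<k} (\<lambda>_. bivariate_normal 1 (dot J a b) 1))"
proof -
  let ?I = "{..<k}"
  have "(\<integral>p. dot ?I (direction ?I (fst \<circ> p)) (direction ?I (snd \<circ> p))
        \<partial>distr (gauss_on (?I \<times> J)) (PiM ?I (\<lambda>_. borel \<Otimes>\<^sub>M borel))
          (\<lambda>Z. \<lambda>i\<in>?I. (mat_vec ?I J Z a i, mat_vec ?I J Z b i)))
      = (\<integral>Z. dot ?I (gauss_round k J a Z) (gauss_round k J b Z) \<partial>gauss_on (?I \<times> J))"
    by (subst integral_distr) (simp_all add: direction_def gauss_round_def)
  then show ?thesis
    using distr_mat_vec_pair[of ?I J a b] assms by (simp add: lessThan_empty_iff)
qed

lemma integral_dot_gauss_round:
  assumes "finite J" "sq_norm J a = 1" "sq_norm J b = 1"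
  shows "(\<integral>Z. dot {..<k} (gauss_round k J a Z) (gauss_round k J b Z) \<partial>gauss_on ({..<k} \<times> J))
    = Fstar k (dot J a b)"
proof (cases "k = 0")
  case False
  have "\<bar>dot J a b\<bar> \<le> 1"
    using assms by (intro abs_dot_le_1) simp_all
  then show ?thesis
    using assms False
    by (simp add: Fstar_planar_unit integral_dot_gauss_round_eq_bivariate sq_norm_planar_unit
        dot_planar_unit)
qed (simp add: Fstar_planar_unit)

lemma Fstar_le_1: "Fstar k \<rho> \<le> 1"
  unfolding Fstar_planar_unit
  by (intro gauss_on.integral_le_const integrable_dot_gauss_round AE_I2
      abs_le_D1[OF abs_dot_gauss_round_le_1])

lemma Fstar_0: "Fstar k 0 = 0"
proof -
  let ?u = "planar_unit 1" and ?v = "planar_unit 0"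
  let ?G = "gauss_on ({..<k} \<times> {..<2})"
  have "Fstar k 0 = Fstar k (dot {..<2} ?u (\<lambda>j. - ?v j))"
    by (simp add: sum_negf dot_planar_unit)
  also have "\<dots> = (\<integral>Z. dot {..<k} (gauss_round k {..<2} ?u Z) (gauss_round k {..<2} (\<lambda>j. - ?v j) Z) \<partial>?G)"
    by (rule integral_dot_gauss_round[symmetric]) (simp_all add: sq_norm_planar_unit)
  also have "\<dots> = - Fstar k 0"
    by (simp add: gauss_round_uminus sum_negf Fstar_planar_unit)
  finally show ?thesis by simp
qed

lemma sum_dot_le_sum_gram:
  assumes "sq_norm I x \<le> 1"
  shows "2 * c * (\<Sum>k\<in>K. dot I x (y k)) \<le> c\<^sup>2 + (\<Sum>k\<in>K. \<Sum>l\<in>K. dot I (y k) (y l))"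
proof -
  have "0 \<le> sq_norm I (\<lambda>i. c * x i - (\<Sum>k\<in>K. y k i))"
    by (simp add: sum_nonneg)
  also have "\<dots> = c\<^sup>2 * sq_norm I x - 2 * c * (\<Sum>i\<in>I. \<Sum>k\<in>K. x i * y k i)
      + (\<Sum>i\<in>I. \<Sum>k\<in>K. \<Sum>l\<in>K. y k i * y l i)"
    by (simp add: power2_eq_square algebra_simps sum.distrib sum_subtractf sum_distrib_left sum_product)
  also have "(\<Sum>i\<in>I. \<Sum>k\<in>K. x i * y k i) = (\<Sum>k\<in>K. dot I x (y k))"
    by (rule sum.swap)
  also have "(\<Sum>i\<in>I. \<Sum>k\<in>K. \<Sum>l\<in>K. y k i * y l i) = (\<Sum>k\<in>K. \<Sum>l\<in>K. dot I (y k) (y l))"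
    by (simp add: sum.swap[of _ K I])
  finally show ?thesis
    using mult_left_mono[OF assms, of "c\<^sup>2"] by simp
qed

lemma sum_Fstar_gram_le:
  assumes "finite K" "k \<in> K" and "\<And>l. l \<in> K \<Longrightarrow> k \<noteq> l \<Longrightarrow> dot J (v k) (v l) = q"
  shows "(\<Sum>l\<in>K. Fstar d (dot J (v k) (v l))) \<le> 1 + (real (card K) - 1) * Fstar d q"
proof -
  have "(\<Sum>l\<in>K. Fstar d (dot J (v k) (v l)))
      = Fstar d (dot J (v k) (v k)) + (\<Sum>l\<in>K - {k}. Fstar d (dot J (v k) (v l)))"
    using assms by (intro sum.remove)
  also have "(\<Sum>l\<in>K - {k}. Fstar d (dot J (v k) (v l))) = (\<Sum>l\<in>K - {k}. Fstar d q)"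
    using assms by (intro sum.cong refl arg_cong[where f = "Fstar d"]) auto
  also have "Fstar d (dot J (v k) (v k)) + \<dots> \<le> 1 + (real (card K) - 1) * Fstar d q"
    using assms Fstar_le_1[of d "dot J (v k) (v k)"] card_gt_0_iff[of K] by (auto simp: of_nat_diff)
  finally show ?thesis .
qed

text \<open>Second-moment bound for \<open>c x - \<Sum> y\<^sub>k\<close>, where \<open>x\<close> and \<open>y\<^sub>k\<close> round a hub \<open>a\<close> and spokes \<open>v\<^sub>k\<close>,
  and \<open>c\<close> is the optimal coefficient.\<close>
lemma Fstar_hub_le:
  assumes "finite J" "finite K" "K \<noteq> {}" and unit: "sq_norm J a = 1" "\<And>k. k \<in> K \<Longrightarrow> sq_norm J (v k) = 1"
    and hub: "\<And>k. k \<in> K \<Longrightarrow> dot J a (v k) = r"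
    and spokes: "\<And>k l. k \<in> K \<Longrightarrow> l \<in> K \<Longrightarrow> k \<noteq> l \<Longrightarrow> dot J (v k) (v l) = q"
  shows "card K * (Fstar d r)\<^sup>2 \<le> 1 + (real (card K) - 1) * Fstar d q"
proof -
  let ?G = "gauss_on ({..<d} \<times> J)"
  let ?x = "gauss_round d J a" and ?y = "\<lambda>k. gauss_round d J (v k)"
  define m where "m = real (card K)"
  have m: "m > 0" using assms(2,3) by (simp add: m_def card_gt_0_iff)
  define c where "c = m * Fstar d r"
  have row: "(\<Sum>l\<in>K. \<integral>Z. dot {..<d} (?y k Z) (?y l Z) \<partial>?G) \<le> 1 + (m - 1) * Fstar d q"
    if "k \<in> K" for k
  proof -
    have "(\<Sum>l\<in>K. \<integral>Z. dot {..<d} (?y k Z) (?y l Z) \<partial>?G) = (\<Sum>l\<in>K. Fstar d (dot J (v k) (v l)))"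
      using \<open>finite J\<close> unit that by (intro sum.cong refl integral_dot_gauss_round) auto
    also have "\<dots> \<le> 1 + (m - 1) * Fstar d q"
      unfolding m_def using \<open>finite K\<close> that spokes by (intro sum_Fstar_gram_le) auto
    finally show ?thesis .
  qed
  have "2 * c * (m * Fstar d r) = 2 * c * (\<Sum>k\<in>K. \<integral>Z. dot {..<d} (?x Z) (?y k Z) \<partial>?G)"
    using unit hub \<open>finite J\<close> by (simp add: integral_dot_gauss_round m_def)
  also have "\<dots> = (\<integral>Z. 2 * c * (\<Sum>k\<in>K. dot {..<d} (?x Z) (?y k Z)) \<partial>?G)"
    by (simp add: Bochner_Integration.integral_sum integrable_dot_gauss_round)
  also have "\<dots> \<le> (\<integral>Z. c\<^sup>2 + (\<Sum>k\<in>K. \<Sum>l\<in>K. dot {..<d} (?y k Z) (?y l Z)) \<partial>?G)"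
    by (intro integral_mono sum_dot_le_sum_gram sq_norm_gauss_round_le_1 integrable_mult_right
        Bochner_Integration.integrable_add Bochner_Integration.integrable_sum
        integrable_dot_gauss_round) simp
  also have "\<dots> = c\<^sup>2 + (\<Sum>k\<in>K. \<Sum>l\<in>K. \<integral>Z. dot {..<d} (?y k Z) (?y l Z) \<partial>?G)"
    by (simp add: Bochner_Integration.integral_sum Bochner_Integration.integrable_sum
        integrable_dot_gauss_round gauss_on.prob_space)
  also have "\<dots> \<le> c\<^sup>2 + m * (1 + (m - 1) * Fstar d q)"
    using sum_mono[OF row] by (simp add: m_def)
  finally have "m * (m * (Fstar d r)\<^sup>2) \<le> m * (1 + (m - 1) * Fstar d q)"
    by (simp add: c_def power2_eq_square)
  then show ?thesis
    using m by (simp add: m_def)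
qed

lemma Fstar_star_le:
  fixes m :: nat and p q s t :: real
  assumes "m \<ge> 1" and unit: "s\<^sup>2 + m * t\<^sup>2 = 1" "p\<^sup>2 + q\<^sup>2 = 1"
  shows "m * (Fstar d (s * p + t * q))\<^sup>2 \<le> 1 + (real m - 1) * Fstar d (p\<^sup>2)"
proof -
  let ?J = "insert 0 {1..m}"
  let ?a = "\<lambda>j. if j = 0 then s else t"
  let ?v = "\<lambda>k j :: nat. if j = 0 then p else if j = k then q else 0"
  have "card {1..m} * (Fstar d (s * p + t * q))\<^sup>2 \<le> 1 + (real (card {1..m}) - 1) * Fstar d (p\<^sup>2)"
  proof (rule Fstar_hub_le[where a = ?a and v = ?v and J = ?J])
    show "sq_norm ?J ?a = 1"
      using unit by simp
    show "sq_norm ?J (?v k) = 1" "dot ?J ?a (?v k) = s * p + t * q" if "k \<in> {1..m}" for k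
      using that unit
      by (simp_all add: if_distrib[of "\<lambda>x. x\<^sup>2"] if_distrib[of "\<lambda>x. _ * x"] cong: if_cong)
    show "dot ?J (?v k) (?v l) = p\<^sup>2" if "k \<noteq> l" for k l
      using that by (simp add: power2_eq_square) (auto intro: sum.neutral)
  qed (use \<open>m \<ge> 1\<close> in auto)
  then show ?thesis by simp
qed

lemma Fstar_le_double:
  assumes "0 < r" "r \<le> 1"
  shows "Fstar k r \<le> 2 * r"
proof (rule power2_le_imp_le)
  define m where "m = nat \<lfloor>1 / r\<^sup>2\<rfloor>"
  have r_sq: "0 < r\<^sup>2" "r\<^sup>2 \<le> 1" using assms by (auto simp: power_le_one)
  then have "1 \<le> 1 / r\<^sup>2" by simp
  then have m: "m \<ge> 1" "real m \<le> 1 / r\<^sup>2" "1 / r\<^sup>2 < real m + 1"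
    by (auto simp: m_def le_nat_iff)
  then have "1 / r\<^sup>2 \<le> 4 * real m" by linarith
  then have m_bounds: "m * r\<^sup>2 \<le> 1" "1 \<le> 4 * m * r\<^sup>2"
    using m(2) r_sq by (simp_all add: field_simps)
  have "m * (Fstar k r)\<^sup>2 \<le> 1"
    using Fstar_star_le[of m "sqrt (1 - m * r\<^sup>2)" r 0 1 k] m(1) m_bounds(1) by (simp add: Fstar_0)
  also have "\<dots> \<le> m * (2 * r)\<^sup>2"
    using m_bounds(2) by (simp add: power_mult_distrib mult_ac)
  finally show "(Fstar k r)\<^sup>2 \<le> (2 * r)\<^sup>2"
    using m(1) by simp
qed (use assms in simp)

lemma Fstar_power2_le:
  assumes "\<bar>r\<bar> \<le> 1"
  shows "(Fstar k r)\<^sup>2 \<le> Fstar k (r\<^sup>2)"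
proof (rule LIMSEQ_le_const)
  let ?F = "Fstar k (r\<^sup>2)"
  show "(\<lambda>m. 1 / real m + (1 - 1 / real m) * ?F) \<longlonglongrightarrow> ?F"
    by real_asymp
  have "r\<^sup>2 \<le> 1" using assms by (simp add: abs_square_le_1)
  then have star: "m * (Fstar k r)\<^sup>2 \<le> 1 + (real m - 1) * ?F" if "m \<ge> 1" for m :: nat
    using Fstar_star_le[of m 1 0 r "sqrt (1 - r\<^sup>2)" k] that by simp
  have "(Fstar k r)\<^sup>2 \<le> 1 / real m + (1 - 1 / real m) * ?F" if "m \<ge> 1" for m :: nat
    using star[OF that] that by (simp add: field_simps)
  then show "\<exists>M. \<forall>m\<ge>M. (Fstar k r)\<^sup>2 \<le> 1 / real m + (1 - 1 / real m) * ?F"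
    by blast
qed

lemma Fstar_power_power2_le:
  assumes "0 \<le> r" "r \<le> 1" "0 \<le> Fstar k r"
  shows "(Fstar k r) ^ (2 ^ j) \<le> Fstar k (r ^ (2 ^ j))"
proof (induction j)
  case (Suc j)
  have "(Fstar k r) ^ (2 ^ Suc j) = ((Fstar k r) ^ (2 ^ j))\<^sup>2"
    by (simp add: power_mult[symmetric] mult.commute)
  also have "\<dots> \<le> (Fstar k (r ^ (2 ^ j)))\<^sup>2"
    using Suc assms by (intro power_mono) auto
  also have "\<dots> \<le> Fstar k ((r ^ (2 ^ j))\<^sup>2)"
    using assms by (intro Fstar_power2_le) (auto simp: power_le_one)
  also have "(r ^ (2 ^ j))\<^sup>2 = r ^ (2 ^ Suc j)"
    by (simp add: power_mult[symmetric] mult.commute)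
  finally show ?case .
qed simp

text \<open>If \<open>F(r) = \<kappa> r\<close> with \<open>\<kappa> > 1\<close>, iterating \<open>F(r)\<^sup>2 \<le> F(r\<^sup>2)\<close> makes \<open>F(s) / s\<close> unbounded as \<open>s \<rightarrow> 0\<close>.\<close>
lemma Fstar_le_self:
  assumes "0 \<le> r" "r \<le> 1"
  shows "Fstar k r \<le> r"
proof (rule ccontr)
  assume "\<not> Fstar k r \<le> r"
  then have "Fstar k r > r" by simp
  then have "r > 0" using assms Fstar_0 by (cases "r = 0") auto
  define \<kappa> where "\<kappa> = Fstar k r / r"
  have "\<kappa> > 1" using \<open>Fstar k r > r\<close> \<open>r > 0\<close> by (simp add: \<kappa>_def)
  have bounded: "\<kappa> ^ (2 ^ j) \<le> 2" for j
  proof -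
    have "(Fstar k r) ^ (2 ^ j) \<le> Fstar k (r ^ (2 ^ j))"
      using assms \<open>Fstar k r > r\<close> by (intro Fstar_power_power2_le) auto
    also have "\<dots> \<le> 2 * r ^ (2 ^ j)"
      using \<open>r > 0\<close> assms by (intro Fstar_le_double) (simp_all add: power_le_one)
    finally show ?thesis
      using \<open>r > 0\<close> by (simp add: \<kappa>_def power_divide divide_le_eq)
  qed
  obtain n where "2 < \<kappa> ^ n" using real_arch_pow[OF \<open>\<kappa> > 1\<close>] by blast
  also have "\<dots> \<le> \<kappa> ^ (2 ^ n)"
    using \<open>\<kappa> > 1\<close> by (intro power_increasing less_imp_le[OF less_exp]) simp
  also note bounded
  finally show False by simp
qed

section \<open>Weighted graphs and Gaussian rounding\<close>

abbreviation total_weight :: "nat \<Rightarrow> (nat \<Rightarrow> nat \<Rightarrow> real) \<Rightarrow> real" where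
  "total_weight N w \<equiv> (\<Sum>j<N. \<Sum>i<j. w i j)"

lemma weighted_graphD:
  assumes "weighted_graph N w"
  shows "i < j \<Longrightarrow> j < N \<Longrightarrow> w i j \<ge> 0" "total_weight N w = 1"
  using assms by (auto simp: weighted_graph_def)

lemma edge_obj_mono:
  assumes "\<And>i j. i < j \<Longrightarrow> j < N \<Longrightarrow> w i j \<ge> 0"
    and "\<And>i j. i < j \<Longrightarrow> j < N \<Longrightarrow> c * (1 - ip i j) \<le> 1 - ip' i j"
  shows "c * edge_obj N w ip \<le> edge_obj N w ip'"
  unfolding edge_obj_def sum_distrib_left
proof (intro sum_mono)
  fix i j assume "j \<in> {..<N}" "i \<in> {..<j}"
  then have "w i j * (c * (1 - ip i j)) \<le> w i j * (1 - ip' i j)"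
    using assms by (intro mult_left_mono) auto
  then show "c * (w i j * (1/4 - 1/4 * ip i j)) \<le> w i j * (1/4 - 1/4 * ip' i j)"
    by (simp add: algebra_simps)
qed

lemma edge_obj_const: "edge_obj N w (\<lambda>_ _. c) = total_weight N w * ((1 - c) / 4)"
  unfolding edge_obj_def sum_distrib_right[symmetric] by (simp add: diff_divide_distrib)

lemma edge_obj_divide: "edge_obj N (\<lambda>i j. w i j / W) ip = edge_obj N w ip / W"
  by (simp add: edge_obj_def sum_divide_distrib)

lemma edge_obj_le_half_weight:
  assumes "\<And>i j. i < j \<Longrightarrow> j < N \<Longrightarrow> w i j \<ge> 0" "\<And>i j. i < j \<Longrightarrow> j < N \<Longrightarrow> -1 \<le> ip i j"
  shows "edge_obj N w ip \<le> total_weight N w / 2"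
  using edge_obj_mono[of N w 1 ip "\<lambda>_ _. -1"] assms by (simp add: edge_obj_const)

lemma (in prob_space)
  assumes ip: "\<And>i j. i < j \<Longrightarrow> j < N \<Longrightarrow> integrable M (\<lambda>\<omega>. ip \<omega> i j)"
  shows integrable_edge_obj: "integrable M (\<lambda>\<omega>. edge_obj N w (ip \<omega>))"
    and expectation_edge_obj:
      "expectation (\<lambda>\<omega>. edge_obj N w (ip \<omega>)) = edge_obj N w (\<lambda>i j. expectation (\<lambda>\<omega>. ip \<omega> i j))"
proof -
  have edge: "has_bochner_integral M (\<lambda>\<omega>. w i j * (1/4 - 1/4 * ip \<omega> i j))
      (w i j * (1/4 - 1/4 * expectation (\<lambda>\<omega>. ip \<omega> i j)))" if "i < j" "j < N" for i j
    using has_bochner_integral_integrable[OF ip[OF that]] prob_space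
    by (intro has_bochner_integral_mult_right has_bochner_integral_diff)
       (auto simp: has_bochner_integral_iff)
  have "has_bochner_integral M (\<lambda>\<omega>. edge_obj N w (ip \<omega>))
      (edge_obj N w (\<lambda>i j. expectation (\<lambda>\<omega>. ip \<omega> i j)))"
    unfolding edge_obj_def by (intro has_bochner_integral_sum edge) auto
  then show "integrable M (\<lambda>\<omega>. edge_obj N w (ip \<omega>))"
    "expectation (\<lambda>\<omega>. edge_obj N w (ip \<omega>)) = edge_obj N w (\<lambda>i j. expectation (\<lambda>\<omega>. ip \<omega> i j))"
    by (simp_all add: has_bochner_integral_iff)
qed

lemma edge_obj_le_ProdG:
  assumes w: "weighted_graph N w" and f: "\<And>i. i < N \<Longrightarrow> norm (f i :: real^3) = 1"
  shows "edge_obj N w (\<lambda>i j. inner (f i) (f j)) \<le> ProdG N w"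
  unfolding ProdG_def
proof (rule cSUP_upper)
  show "bdd_above ((\<lambda>f. edge_obj N w (\<lambda>i j. inner (f i) (f j)))
      ` {f :: nat \<Rightarrow> real^3. \<forall>i<N. f i \<in> sphere 0 1})"
  proof (rule bdd_aboveI2)
    fix f :: "nat \<Rightarrow> real^3" assume f: "f \<in> {f. \<forall>i<N. f i \<in> sphere 0 1}"
    have "-1 \<le> inner (f i) (f j)" if "i < j" "j < N" for i j
      using Cauchy_Schwarz_ineq2[of "f i" "f j"] f that by (simp add: abs_le_iff)
    then show "edge_obj N w (\<lambda>i j. inner (f i) (f j)) \<le> total_weight N w / 2"
      by (intro edge_obj_le_half_weight weighted_graphD(1)[OF w])
  qed
qed (use f in simp)

lemma ProdG_least:
  assumes "\<And>f :: nat \<Rightarrow> real^3. (\<And>i. i < N \<Longrightarrow> norm (f i) = 1)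
      \<Longrightarrow> edge_obj N w (\<lambda>i j. inner (f i) (f j)) \<le> B"
  shows "ProdG N w \<le> B"
  unfolding ProdG_def
proof (rule cSUP_least)
  have "(\<lambda>_. axis 1 1) \<in> {f :: nat \<Rightarrow> real^3. \<forall>i<N. f i \<in> sphere 0 1}"
    by (simp add: norm_axis_1)
  then show "{f :: nat \<Rightarrow> real^3. \<forall>i<N. f i \<in> sphere 0 1} \<noteq> {}"
    by (metis empty_iff)
qed (use assms in simp)

lemma edge_obj_le_SDP_Prod:
  assumes w: "weighted_graph N w" and "n \<le> N" and f: "\<And>i. i < N \<Longrightarrow> sq_norm {..<n} (f i) = 1"
  shows "edge_obj N w (\<lambda>i j. dot {..<n} (f i) (f j)) \<le> SDP_Prod N w"
proof -
  define g where "g i k = (if k < n then f i k else 0)" for i k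
  have g: "dot {..<N} (g i) (g j) = dot {..<n} (f i) (f j)"
    "sq_norm {..<N} (g i) = sq_norm {..<n} (f i)" for i j
    using \<open>n \<le> N\<close> by (auto intro!: sum.mono_neutral_cong_right simp: g_def split: if_splits)
  have "edge_obj N w (\<lambda>i j. dot {..<N} (g i) (g j)) \<le> SDP_Prod N w"
    unfolding SDP_Prod_def
  proof (rule cSUP_upper)
    show "bdd_above ((\<lambda>f. edge_obj N w (\<lambda>i j. dot {..<N} (f i) (f j)))
        ` {f. \<forall>i<N. sq_norm {..<N} (f i) = 1})"
    proof (rule bdd_aboveI2)
      fix f :: "nat \<Rightarrow> nat \<Rightarrow> real" assume f: "f \<in> {f. \<forall>i<N. sq_norm {..<N} (f i) = 1}"
      have "-1 \<le> dot {..<N} (f i) (f j)" if "i < j" "j < N" for i j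
        using abs_dot_le_1[of "f i" "{..<N}" "f j"] f that by (simp add: abs_le_iff)
      then show "edge_obj N w (\<lambda>i j. dot {..<N} (f i) (f j)) \<le> total_weight N w / 2"
        by (intro edge_obj_le_half_weight weighted_graphD(1)[OF w])
    qed
  qed (use f in \<open>simp add: g\<close>)
  then show ?thesis by (simp only: g)
qed

lemma sq_norm_standard_basis: "i < N \<Longrightarrow> sq_norm {..<N} (\<lambda>k. if i = k then 1 else 0) = 1" for i N :: nat
  by (simp add: if_distrib[of "\<lambda>x. x\<^sup>2"] cong: if_cong)

lemma SDP_Prod_least:
  assumes "\<And>f :: nat \<Rightarrow> nat \<Rightarrow> real. (\<And>i. i < N \<Longrightarrow> sq_norm {..<N} (f i) = 1)
      \<Longrightarrow> edge_obj N w (\<lambda>i j. dot {..<N} (f i) (f j)) \<le> B"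
  shows "SDP_Prod N w \<le> B"
  unfolding SDP_Prod_def
proof (rule cSUP_least)
  have "(\<lambda>i k. if i = k then 1 else 0) \<in> {f :: nat \<Rightarrow> nat \<Rightarrow> real. \<forall>i<N. sq_norm {..<N} (f i) = 1}"
    using sq_norm_standard_basis by simp
  then show "{f :: nat \<Rightarrow> nat \<Rightarrow> real. \<forall>i<N. sq_norm {..<N} (f i) = 1} \<noteq> {}"
    by (metis empty_iff)
qed (use assms in simp)

lemma SDP_Prod_pos:
  assumes w: "weighted_graph N w"
  shows "SDP_Prod N w > 0"
proof -
  let ?e = "\<lambda>i k :: nat. if i = k then 1 else 0 :: real"
  have "edge_obj N w (\<lambda>i j. dot {..<N} (?e i) (?e j)) = edge_obj N w (\<lambda>_ _. 0)"
    unfolding edge_obj_def by (intro sum.cong refl) (simp add: sum.neutral)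
  then have "1 / 4 = edge_obj N w (\<lambda>i j. dot {..<N} (?e i) (?e j))"
    using weighted_graphD(2)[OF w] by (simp add: edge_obj_const)
  also have "\<dots> \<le> SDP_Prod N w"
    using w by (intro edge_obj_le_SDP_Prod sq_norm_standard_basis) simp_all
  finally show ?thesis by simp
qed

lemma AE_sq_norm_gauss_round:
  assumes "k > 0" "finite J" "sq_norm J a = 1"
  shows "AE Z in gauss_on ({..<k} \<times> J). sq_norm {..<k} (gauss_round k J a Z) = 1"
proof -
  have "AE t in std_normal. t \<noteq> 0"
    using AE_lborel_singleton[of "0::real"] by (subst AE_density) auto
  then have "AE x in gauss_on {..<k}. x 0 \<noteq> 0"
    unfolding gauss_on_def using \<open>k > 0\<close>
    by (intro AE_PiM_component std_normal.prob_space_axioms) simp_all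
  then have "AE x in distr (gauss_on ({..<k} \<times> J)) (gauss_on {..<k}) (\<lambda>Z. mat_vec {..<k} J Z a).
      x 0 \<noteq> 0"
    using assms by (subst distr_mat_vec) (auto simp: lessThan_empty_iff)
  then have "AE Z in gauss_on ({..<k} \<times> J). mat_vec {..<k} J Z a 0 \<noteq> 0"
    by (rule AE_distrD[OF measurable_mat_vec])
  then show ?thesis
  proof eventually_elim
    fix Z assume "mat_vec {..<k} J Z a 0 \<noteq> 0"
    then have "sq_norm {..<k} (mat_vec {..<k} J Z a) \<noteq> 0"
      using \<open>k > 0\<close> by (auto simp: sum_nonneg_eq_0_iff)
    then show "sq_norm {..<k} (gauss_round k J a Z) = 1"
      unfolding gauss_round_def sq_norm_direction by simp
  qed
qed

lemma edge_obj_Fstar_le_ProdG: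
  assumes w: "weighted_graph N w" and "finite J" and f: "\<And>i. i < N \<Longrightarrow> sq_norm J (f i) = 1"
  shows "edge_obj N w (\<lambda>i j. Fstar 3 (dot J (f i) (f j))) \<le> ProdG N w"
proof -
  let ?G = "gauss_on ({..<3} \<times> J)"
  let ?s = "\<lambda>i. gauss_round 3 J (f i)"
  let ?ip = "\<lambda>Z i j. dot {..<3} (?s i Z) (?s j Z)"
  have "AE Z in ?G. \<forall>i\<in>{..<N}. sq_norm {..<3} (?s i Z) = 1"
    using \<open>finite J\<close> f by (intro AE_finite_allI AE_sq_norm_gauss_round) auto
  then have feasible: "AE Z in ?G. edge_obj N w (?ip Z) \<le> ProdG N w"
  proof eventually_elim
    fix Z assume unit: "\<forall>i\<in>{..<N}. sq_norm {..<3} (?s i Z) = 1"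
    define g where "g i = (vector [?s i Z 0, ?s i Z 1, ?s i Z 2] :: real^3)" for i
    have inner_g: "inner (g i) (g j) = ?ip Z i j" for i j
      by (simp add: g_def inner_vec_def sum_3 eval_nat_numeral)
    have "edge_obj N w (\<lambda>i j. inner (g i) (g j)) \<le> ProdG N w"
      using unit by (intro edge_obj_le_ProdG[OF w]) (simp add: norm_eq_1 inner_g power2_eq_square)
    then show "edge_obj N w (?ip Z) \<le> ProdG N w"
      by (simp only: inner_g)
  qed
  have "edge_obj N w (\<lambda>i j. Fstar 3 (dot J (f i) (f j))) = edge_obj N w (\<lambda>i j. \<integral>Z. ?ip Z i j \<partial>?G)"
    unfolding edge_obj_def using \<open>finite J\<close> f
    by (intro sum.cong refl) (simp add: integral_dot_gauss_round)
  also have "\<dots> = (\<integral>Z. edge_obj N w (?ip Z) \<partial>?G)"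
    by (intro gauss_on.expectation_edge_obj[symmetric] integrable_dot_gauss_round)
  also have "\<dots> \<le> ProdG N w"
    by (intro gauss_on.integral_le_const gauss_on.integrable_edge_obj integrable_dot_gauss_round
        feasible)
  finally show ?thesis .
qed

lemma alpha_BOV_nonneg: "alpha_BOV \<ge> 0"
  unfolding alpha_BOV_def by (intro cINF_greatest) (auto intro!: divide_nonneg_nonneg Fstar_le_1)

lemma alpha_BOV_mult_le:
  assumes "\<bar>\<rho>\<bar> \<le> 1"
  shows "alpha_BOV * (1 - \<rho>) \<le> 1 - Fstar 3 \<rho>"
proof (cases "\<rho> = 1")
  case False
  then have "\<rho> \<in> {-1..<1}" using assms by (auto simp: abs_le_iff)
  then have "alpha_BOV \<le> (1 - Fstar 3 \<rho>) / (1 - \<rho>)"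
    unfolding alpha_BOV_def
    by (intro cINF_lower bdd_belowI2[of _ 0]) (auto intro!: divide_nonneg_nonneg Fstar_le_1)
  then show ?thesis using \<open>\<rho> \<in> {-1..<1}\<close> by (simp add: le_divide_eq)
qed (simp add: Fstar_le_1)

lemma alpha_BOV_mult_SDP_Prod_le:
  assumes w: "weighted_graph N w"
  shows "alpha_BOV * SDP_Prod N w \<le> ProdG N w"
proof -
  have rounding: "alpha_BOV * edge_obj N w (\<lambda>i j. dot {..<N} (f i) (f j)) \<le> ProdG N w"
    if f: "\<And>i. i < N \<Longrightarrow> sq_norm {..<N} (f i) = 1" for f :: "nat \<Rightarrow> nat \<Rightarrow> real"
  proof -
    have "alpha_BOV * edge_obj N w (\<lambda>i j. dot {..<N} (f i) (f j))
        \<le> edge_obj N w (\<lambda>i j. Fstar 3 (dot {..<N} (f i) (f j)))"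
      using f by (intro edge_obj_mono weighted_graphD(1)[OF w] alpha_BOV_mult_le abs_dot_le_1) auto
    also have "\<dots> \<le> ProdG N w"
      using f by (intro edge_obj_Fstar_le_ProdG[OF w]) simp_all
    finally show ?thesis .
  qed
  show ?thesis
  proof (cases "alpha_BOV = 0")
    case True
    then show ?thesis using rounding[OF sq_norm_standard_basis] by simp
  next
    case False
    then have "alpha_BOV > 0" using alpha_BOV_nonneg by simp
    have "SDP_Prod N w \<le> ProdG N w / alpha_BOV"
      using rounding \<open>alpha_BOV > 0\<close>
      by (intro SDP_Prod_least) (simp add: pos_le_divide_eq mult.commute[of _ alpha_BOV])
    then show ?thesis
      using \<open>alpha_BOV > 0\<close> by (simp add: pos_le_divide_eq mult.commute)
  qed
qed

lemma alpha_BOV_le_ratio: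
  assumes "weighted_graph N w"
  shows "alpha_BOV \<le> ProdG N w / SDP_Prod N w"
  using alpha_BOV_mult_SDP_Prod_le[OF assms] SDP_Prod_pos[OF assms] by (simp add: le_divide_eq)

section \<open>The graph of a random edge\<close>

lemma measurable_Pair_count_space:
  assumes "f \<in> M \<rightarrow>\<^sub>M count_space A" "g \<in> M \<rightarrow>\<^sub>M count_space B" "finite A" "finite B"
  shows "(\<lambda>x. (f x, g x)) \<in> M \<rightarrow>\<^sub>M count_space (A \<times> B)"
  using measurable_Pair[OF assms(1,2)] assms(3,4) by (simp add: pair_measure_count_space)

lemma (in prob_space)
  fixes h :: "'v \<Rightarrow> real"
  assumes Z: "Z \<in> M \<rightarrow>\<^sub>M count_space S" and S: "finite S"
  shows integrable_finite_range: "integrable M (\<lambda>\<omega>. h (Z \<omega>))"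
    and expectation_finite_range:
      "expectation (\<lambda>\<omega>. h (Z \<omega>)) = (\<Sum>s\<in>S. h s * prob {\<omega> \<in> space M. Z \<omega> = s})"
proof -
  have fibre: "{\<omega> \<in> space M. Z \<omega> = s} \<in> events" if "s \<in> S" for s
    using measurable_sets[OF Z, of "{s}"] that by (simp add: vimage_def Int_def conj_commute)
  have indicators: "h (Z \<omega>) = (\<Sum>s\<in>S. h s * indicator {\<omega> \<in> space M. Z \<omega> = s} \<omega>)"
    if "\<omega> \<in> space M" for \<omega>
    using that S measurable_space[OF Z that] by (simp add: indicator_def if_distrib cong: if_cong)
  have "has_bochner_integral M (\<lambda>\<omega>. \<Sum>s\<in>S. h s * indicator {\<omega> \<in> space M. Z \<omega> = s} \<omega>)
      (\<Sum>s\<in>S. h s * prob {\<omega> \<in> space M. Z \<omega> = s})"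
    using fibre
    by (intro has_bochner_integral_sum has_bochner_integral_mult_right
        has_bochner_integral_real_indicator) (auto simp: less_top[symmetric])
  then have "has_bochner_integral M (\<lambda>\<omega>. h (Z \<omega>)) (\<Sum>s\<in>S. h s * prob {\<omega> \<in> space M. Z \<omega> = s})"
    by (simp add: indicators cong: has_bochner_integral_cong)
  then show "integrable M (\<lambda>\<omega>. h (Z \<omega>))"
    "expectation (\<lambda>\<omega>. h (Z \<omega>)) = (\<Sum>s\<in>S. h s * prob {\<omega> \<in> space M. Z \<omega> = s})"
    by (simp_all add: has_bochner_integral_iff)
qed

definition (in prob_space) edge_prob :: "('a \<Rightarrow> nat) \<Rightarrow> ('a \<Rightarrow> nat) \<Rightarrow> nat \<Rightarrow> nat \<Rightarrow> real" where
  "edge_prob X Y i j = prob {\<omega> \<in> space M. (max (X \<omega>) (Y \<omega>), min (X \<omega>) (Y \<omega>)) = (j, i)}"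

text \<open>The loops, where \<open>X = Y\<close>, need no edge: they contribute nothing to the right-hand side.\<close>
lemma (in prob_space) edge_obj_edge_prob:
  assumes X: "X \<in> M \<rightarrow>\<^sub>M count_space {..<N}" and Y: "Y \<in> M \<rightarrow>\<^sub>M count_space {..<N}"
    and sym: "\<And>i j. ip i j = ip j i" and diag: "\<And>i. i < N \<Longrightarrow> ip i i = 1"
  shows "edge_obj N (edge_prob X Y) ip = (1 - expectation (\<lambda>\<omega>. ip (X \<omega>) (Y \<omega>))) / 4"
proof -
  let ?Z = "\<lambda>\<omega>. (max (X \<omega>) (Y \<omega>), min (X \<omega>) (Y \<omega>))"
  let ?V = "{..<N} \<times> {..<N}"
  have XY: "(\<lambda>\<omega>. (X \<omega>, Y \<omega>)) \<in> M \<rightarrow>\<^sub>M count_space ?V"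
    using X Y by (intro measurable_Pair_count_space) simp_all
  have "(\<lambda>(x, y). (max x y, min x y)) \<in> count_space ?V \<rightarrow>\<^sub>M count_space ?V"
    by auto
  from measurable_compose[OF XY this] have Z: "?Z \<in> M \<rightarrow>\<^sub>M count_space ?V"
    by simp
  have "(1 - expectation (\<lambda>\<omega>. ip (X \<omega>) (Y \<omega>))) / 4 = expectation (\<lambda>\<omega>. 1/4 - 1/4 * ip (X \<omega>) (Y \<omega>))"
    using integrable_finite_range[OF XY, of "\<lambda>(i, j). ip i j"] prob_space by simp
  also have "\<dots> = expectation (\<lambda>\<omega>. (\<lambda>(j, i). 1/4 - 1/4 * ip i j) (?Z \<omega>))"
    by (intro Bochner_Integration.integral_cong refl) (auto simp: max_def min_def sym)
  also have "\<dots> = (\<Sum>(j, i)\<in>?V. edge_prob X Y i j * (1/4 - 1/4 * ip i j))"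
    by (subst expectation_finite_range[OF Z])
       (simp_all add: edge_prob_def case_prod_beta prod_eq_iff mult.commute)
  also have "\<dots> = (\<Sum>(j, i)\<in>Sigma {..<N} lessThan. edge_prob X Y i j * (1/4 - 1/4 * ip i j))"
  proof (intro sum.mono_neutral_right ballI)
    fix p assume "p \<in> ?V - Sigma {..<N} lessThan"
    then obtain i j where p: "p = (j, i)" "i < N" "\<not> i < j" by auto
    have "edge_prob X Y i j * (1/4 - 1/4 * ip i j) = 0"
    proof (cases "i = j")
      case False
      then have "{\<omega> \<in> space M. ?Z \<omega> = (j, i)} = {}" using p(3) by auto
      then show ?thesis by (simp only: edge_prob_def measure_empty mult_zero_left)
    qed (use p diag in simp)
    then show "(case p of (j, i) \<Rightarrow> edge_prob X Y i j * (1/4 - 1/4 * ip i j)) = 0"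
      by (simp only: p prod.case)
  qed auto
  also have "\<dots> = edge_obj N (edge_prob X Y) ip"
    by (simp add: edge_obj_def sum.Sigma)
  finally show ?thesis ..
qed

lemma (in prob_space) total_weight_edge_prob_pos:
  assumes X: "X \<in> M \<rightarrow>\<^sub>M count_space {..<N}" and Y: "Y \<in> M \<rightarrow>\<^sub>M count_space {..<N}"
    and c: "\<And>i. i < N \<Longrightarrow> sq_norm I (c i) = 1"
    and less: "expectation (\<lambda>\<omega>. dot I (c (X \<omega>)) (c (Y \<omega>))) < 1"
  shows "total_weight N (edge_prob X Y) > 0"
proof -
  have "0 < edge_obj N (edge_prob X Y) (\<lambda>i j. dot I (c i) (c j))"
    using less c by (subst edge_obj_edge_prob[OF X Y]) (simp_all add: mult.commute power2_eq_square)
  also have "\<dots> \<le> total_weight N (edge_prob X Y) / 2"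
  proof (rule edge_obj_le_half_weight)
    show "-1 \<le> dot I (c i) (c j)" if "i < j" "j < N" for i j
      using abs_dot_le_1[of "c i" I "c j"] c that by (simp add: abs_le_iff)
  qed (simp add: edge_prob_def)
  finally show ?thesis by simp
qed

lemma (in prob_space) ProdG_edge_prob_le:
  assumes X: "X \<in> M \<rightarrow>\<^sub>M count_space {..<N}" and Y: "Y \<in> M \<rightarrow>\<^sub>M count_space {..<N}"
    and prod: "\<And>f :: nat \<Rightarrow> real^3. (\<And>i. i < N \<Longrightarrow> norm (f i) = 1)
      \<Longrightarrow> t \<le> expectation (\<lambda>\<omega>. inner (f (X \<omega>)) (f (Y \<omega>)))"
    and "W > 0"
  shows "ProdG N (\<lambda>i j. edge_prob X Y i j / W) \<le> (1 - t) / 4 / W"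
proof (rule ProdG_least)
  fix f :: "nat \<Rightarrow> real^3" assume f: "\<And>i. i < N \<Longrightarrow> norm (f i) = 1"
  have "edge_obj N (edge_prob X Y) (\<lambda>i j. inner (f i) (f j))
      = (1 - expectation (\<lambda>\<omega>. inner (f (X \<omega>)) (f (Y \<omega>)))) / 4"
    using f by (intro edge_obj_edge_prob[OF X Y]) (auto simp: inner_commute norm_eq_1)
  then show "edge_obj N (\<lambda>i j. edge_prob X Y i j / W) (\<lambda>i j. inner (f i) (f j)) \<le> (1 - t) / 4 / W"
    unfolding edge_obj_divide using prod[of f] f \<open>W > 0\<close> by (intro divide_right_mono) simp_all
qed

text \<open>Discarding the loops and renormalising multiplies both objectives by the same factor.\<close>
lemma (in prob_space) exists_weighted_graph_ratio_le:
  assumes X: "X \<in> M \<rightarrow>\<^sub>M count_space {..<N}" and Y: "Y \<in> M \<rightarrow>\<^sub>M count_space {..<N}"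
    and "n \<le> N" and c: "\<And>i. i < N \<Longrightarrow> sq_norm {..<n} (c i) = 1"
    and sdp: "expectation (\<lambda>\<omega>. dot {..<n} (c (X \<omega>)) (c (Y \<omega>))) \<le> s" "s < 1"
    and prod: "\<And>f :: nat \<Rightarrow> real^3. (\<And>i. i < N \<Longrightarrow> norm (f i) = 1)
      \<Longrightarrow> t \<le> expectation (\<lambda>\<omega>. inner (f (X \<omega>)) (f (Y \<omega>)))"
  obtains w where "weighted_graph N w" "ProdG N w / SDP_Prod N w \<le> (1 - t) / (1 - s)"
proof -
  let ?p = "edge_prob X Y"
  let ?W = "total_weight N ?p"
  let ?w = "\<lambda>i j. ?p i j / ?W"
  have "?W > 0"
    using total_weight_edge_prob_pos[OF X Y c] sdp by simp
  then have w: "weighted_graph N ?w"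
    by (simp add: weighted_graph_def edge_prob_def flip: sum_divide_distrib)
  have ProdG: "ProdG N ?w \<le> (1 - t) / 4 / ?W"
    using prod \<open>?W > 0\<close> by (rule ProdG_edge_prob_le[OF X Y])
  have "(1 - s) / 4 \<le> edge_obj N ?p (\<lambda>i j. dot {..<n} (c i) (c j))"
    using sdp(1) c by (subst edge_obj_edge_prob[OF X Y]) (simp_all add: mult.commute power2_eq_square)
  then have "(1 - s) / 4 / ?W \<le> edge_obj N ?w (\<lambda>i j. dot {..<n} (c i) (c j))"
    unfolding edge_obj_divide using \<open>?W > 0\<close> by (intro divide_right_mono) simp_all
  also have "\<dots> \<le> SDP_Prod N ?w"
    by (rule edge_obj_le_SDP_Prod[OF w \<open>n \<le> N\<close> c])
  finally have SDP: "(1 - s) / 4 / ?W \<le> SDP_Prod N ?w" .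
  have "expectation (\<lambda>_. inner (axis 1 1 :: real^3) (axis 1 1)) = 1"
    using prob_space by (simp add: inner_axis_axis)
  then have "t \<le> 1" using prod[of "\<lambda>_. axis 1 1"] by (simp add: norm_axis_1)
  then have "ProdG N ?w / SDP_Prod N ?w \<le> ((1 - t) / 4 / ?W) / ((1 - s) / 4 / ?W)"
    using ProdG SDP sdp(2) \<open>?W > 0\<close> by (intro frac_le) auto
  also have "\<dots> = (1 - t) / (1 - s)" using \<open>?W > 0\<close> by simp
  finally show thesis using that w by blast
qed

section \<open>Concentration of Gaussian vectors\<close>

lemma has_bochner_integral_std_normal_moments:
  shows "has_bochner_integral std_normal (\<lambda>t. t) 0"
    and "has_bochner_integral std_normal (\<lambda>t. t\<^sup>2) 1"
    and "has_bochner_integral std_normal (\<lambda>t. t ^ 4) 3"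
proof -
  show "has_bochner_integral std_normal (\<lambda>t. t) 0"
    using std_normal_moment_odd[of 0] by (intro has_bochner_integral_density) simp_all
  show "has_bochner_integral std_normal (\<lambda>t. t\<^sup>2) 1"
    using std_normal_moment_even[of 1] by (intro has_bochner_integral_density) simp_all
  show "has_bochner_integral std_normal (\<lambda>t. t ^ 4) 3"
    using std_normal_moment_even[of 2]
    by (intro has_bochner_integral_density) (simp_all add: fact_numeral)
qed

lemma has_bochner_integral_std_normal_sq_minus_1:
  shows "has_bochner_integral std_normal (\<lambda>t. t\<^sup>2 - 1) 0"
    and "has_bochner_integral std_normal (\<lambda>t. (t\<^sup>2 - 1)\<^sup>2) 2"
proof -
  have one: "has_bochner_integral std_normal (\<lambda>_. 1) (1 :: real)"
    using std_normal.prob_space by (simp add: has_bochner_integral_iff)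
  note moments = has_bochner_integral_std_normal_moments
  show "has_bochner_integral std_normal (\<lambda>t. t\<^sup>2 - 1) 0"
    using has_bochner_integral_diff[OF moments(2) one] by simp
  have "has_bochner_integral std_normal (\<lambda>t. t ^ 4 - 2 * t\<^sup>2 + 1) (3 - 2 * 1 + 1)"
    by (intro has_bochner_integral_add has_bochner_integral_diff has_bochner_integral_mult_right
        moments one)
  also have "(\<lambda>t. t ^ 4 - 2 * t\<^sup>2 + 1) = (\<lambda>t. (t\<^sup>2 - 1)\<^sup>2 :: real)"
    by (simp add: fun_eq_iff power2_diff flip: power_mult)
  finally show "has_bochner_integral std_normal (\<lambda>t. (t\<^sup>2 - 1)\<^sup>2) 2"
    by simp
qed

lemma has_bochner_integral_gauss_on_component:
  fixes h :: "real \<Rightarrow> real"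
  assumes "i \<in> I" and h: "has_bochner_integral std_normal h r"
  shows "has_bochner_integral (gauss_on I) (\<lambda>z. h (z i)) r"
proof -
  have "distr (gauss_on I) std_normal (\<lambda>z. z i) = std_normal"
    unfolding gauss_on_def using \<open>i \<in> I\<close> by (intro distr_PiM_component std_normal.prob_space_axioms)
  moreover have "(\<lambda>z. z i) \<in> gauss_on I \<rightarrow>\<^sub>M std_normal"
    using \<open>i \<in> I\<close> by simp
  moreover have "h \<in> borel_measurable std_normal"
    using h by (rule borel_measurable_has_bochner_integral)
  ultimately show ?thesis
    using h by (metis has_bochner_integral_iff integrable_distr_eq integral_distr)
qed

lemma has_bochner_integral_gauss_on_orthogonal:
  fixes h :: "real \<Rightarrow> real"
  assumes "finite I" "i \<in> I" "j \<in> I"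
    and h: "has_bochner_integral std_normal h 0" "has_bochner_integral std_normal (\<lambda>t. (h t)\<^sup>2) v"
  shows "has_bochner_integral (gauss_on I) (\<lambda>z. h (z i) * h (z j)) (if i = j then v else 0)"
proof (cases "i = j")
  case True
  then show ?thesis
    using has_bochner_integral_gauss_on_component[OF \<open>i \<in> I\<close> h(2)] by (simp add: power2_eq_square)
next
  case False
  have [measurable]: "h \<in> borel_measurable borel"
    using borel_measurable_has_bochner_integral[OF h(1)] by simp
  have component: "integrable (gauss_on I) (\<lambda>z. h (z k))"
    "gauss_on.expectation I (\<lambda>z. h (z k)) = 0" if "k \<in> {i, j}" for k
    using has_bochner_integral_gauss_on_component[OF _ h(1), of k I] assms(2,3) that
    by (auto simp: has_bochner_integral_iff)
  have "prob_space.indep_vars (gauss_on I) (\<lambda>_. std_normal) (\<lambda>k z. z k) {i, j}"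
    using assms(2,3) by (intro gauss_on.indep_vars_subset[OF indep_vars_gauss_on[OF \<open>finite I\<close>]]) simp
  then have indep: "prob_space.indep_vars (gauss_on I) (\<lambda>_. borel) (\<lambda>k z. h (z k)) {i, j}"
    by (rule gauss_on.indep_vars_compose2) simp
  from gauss_on.indep_vars_integrable[OF _ indep component(1)]
    gauss_on.indep_vars_lebesgue_integral[OF _ indep component(1)]
  show ?thesis
    using False component by (simp add: has_bochner_integral_iff)
qed

lemma has_bochner_integral_gauss_on_sum_sq:
  fixes h :: "real \<Rightarrow> real" and v :: real
  assumes "finite I"
    and h: "has_bochner_integral std_normal h 0" "has_bochner_integral std_normal (\<lambda>t. (h t)\<^sup>2) v"
  shows "has_bochner_integral (gauss_on I) (\<lambda>z. (\<Sum>i\<in>I. h (z i))\<^sup>2) (card I * v)"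
proof -
  have "has_bochner_integral (gauss_on I) (\<lambda>z. \<Sum>i\<in>I. \<Sum>j\<in>I. h (z i) * h (z j))
      (\<Sum>i\<in>I. \<Sum>j\<in>I. if i = j then v else 0)"
    using assms by (intro has_bochner_integral_sum has_bochner_integral_gauss_on_orthogonal)
  then show ?thesis
    using \<open>finite I\<close> by (simp add: power2_eq_square sum_product)
qed

definition dispersion :: "nat \<Rightarrow> (nat \<Rightarrow> real) \<Rightarrow> real" where
  "dispersion n x = (sq_norm {..<n} x / n - 1)\<^sup>2"

lemma has_bochner_integral_dispersion:
  assumes "n > 0"
  shows "has_bochner_integral (gauss_on {..<n}) (dispersion n) (2 / n)"
proof -
  have "dispersion n x = (\<Sum>i<n. (x i)\<^sup>2 - 1)\<^sup>2 / n\<^sup>2" for x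
  proof -
    have "sq_norm {..<n} x / n - 1 = (\<Sum>i<n. (x i)\<^sup>2 - 1) / n"
      using assms by (simp add: sum_subtractf diff_divide_distrib)
    then show ?thesis by (simp add: dispersion_def power_divide)
  qed
  moreover have "has_bochner_integral (gauss_on {..<n}) (\<lambda>x. (\<Sum>i<n. (x i)\<^sup>2 - 1)\<^sup>2 / n\<^sup>2)
      (real (card {..<n}) * 2 / n\<^sup>2)"
    by (intro has_bochner_integral_divide finite_lessThan
        has_bochner_integral_gauss_on_sum_sq[where h = "\<lambda>t. t\<^sup>2 - 1"]
        has_bochner_integral_std_normal_sq_minus_1)
  ultimately show ?thesis
    using assms by (simp add: power2_eq_square[of "real n"] cong: has_bochner_integral_cong)
qed

lemma has_bochner_integral_dot_mat_vec:
  assumes "finite I" "finite J"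
  shows "has_bochner_integral (gauss_on (I \<times> J))
    (\<lambda>Z. dot I (mat_vec I J Z a) (mat_vec I J Z b)) (card I * dot J a b)"
proof -
  have "has_bochner_integral (gauss_on (I \<times> J))
      (\<lambda>Z. \<Sum>i\<in>I. \<Sum>j\<in>J. \<Sum>k\<in>J. a j * b k * (Z (i, j) * Z (i, k)))
      (\<Sum>i\<in>I. \<Sum>j\<in>J. \<Sum>k\<in>J. a j * b k * (if (i, j) = (i, k) then 1 else 0))"
    using assms
    by (intro has_bochner_integral_sum has_bochner_integral_mult_right
        has_bochner_integral_gauss_on_orthogonal has_bochner_integral_std_normal_moments) auto
  also have "(\<lambda>Z. \<Sum>i\<in>I. \<Sum>j\<in>J. \<Sum>k\<in>J. a j * b k * (Z (i, j) * Z (i, k)))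
      = (\<lambda>Z. dot I (mat_vec I J Z a) (mat_vec I J Z b))"
    by (simp add: mat_vec_def sum_product mult_ac)
  also have "(\<Sum>i\<in>I. \<Sum>j\<in>J. \<Sum>k\<in>J. a j * b k * (if (i, j) = (i, k) then 1 else 0)) = card I * dot J a b"
    using \<open>finite J\<close> by (simp add: if_distrib[of "\<lambda>x. _ * x"] cong: if_cong)
  finally show ?thesis .
qed

section \<open>Discretising the sphere\<close>

text \<open>The default value at the zero vector makes every vertex of the discretised sphere a unit vector,
  as feasibility for the semidefinite program requires.\<close>
definition unit_vector :: "nat \<Rightarrow> (nat \<Rightarrow> real) \<Rightarrow> nat \<Rightarrow> real" where
  "unit_vector n x =
    (if sq_norm {..<n} x = 0 then (\<lambda>k. if k = 0 then 1 else 0) else direction {..<n} x)"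

lemma sq_norm_unit_vector: "n > 0 \<Longrightarrow> sq_norm {..<n} (unit_vector n x) = 1"
  by (simp add: unit_vector_def sq_norm_direction if_distrib[of "\<lambda>x. x\<^sup>2"] cong: if_cong)

lemma abs_unit_vector_le_1:
  assumes "k < n"
  shows "\<bar>unit_vector n x k\<bar> \<le> 1"
proof -
  have "(unit_vector n x k)\<^sup>2 \<le> sq_norm {..<n} (unit_vector n x)"
    using assms by (intro member_le_sum) auto
  then show ?thesis using assms by (simp add: sq_norm_unit_vector abs_square_le_1)
qed

lemma dot_unit_vector: "dot {..<n} (unit_vector n x) x = sqrt (sq_norm {..<n} x)"
proof (cases "sq_norm {..<n} x = 0")
  case True
  then have "\<forall>k\<in>{..<n}. x k = 0" by (subst (asm) sum_nonneg_eq_0_iff) auto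
  then show ?thesis by simp
next
  case False
  then have "dot {..<n} (unit_vector n x) x = sq_norm {..<n} x / sqrt (sq_norm {..<n} x)"
    by (simp add: unit_vector_def direction_def power2_eq_square sum_divide_distrib)
  also have "\<dots> = sqrt (sq_norm {..<n} x)" by (simp add: real_div_sqrt sum_nonneg)
  finally show ?thesis .
qed

lemma measurable_unit_vector [measurable]:
  assumes "k < n"
  shows "(\<lambda>x. unit_vector n x k) \<in> borel_measurable (gauss_on {..<n})"
proof -
  have "(\<lambda>x. unit_vector n x k)
      = (\<lambda>x. if sq_norm {..<n} x = 0 then if k = 0 then 1 else 0 else direction {..<n} x k)"
    by (simp add: unit_vector_def fun_eq_iff)
  moreover have "sq_norm {..<n} \<in> borel_measurable (gauss_on {..<n})"
    by measurable
  moreover have "(\<lambda>x. direction {..<n} x k) \<in> borel_measurable (gauss_on {..<n})"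
    using assms by (simp add: direction_def)
  ultimately show ?thesis by simp
qed

lemma unit_vector_near_rescaled:
  assumes "n > 0"
  shows "sq_dist {..<n} (unit_vector n x) (\<lambda>k. x k / sqrt n) \<le> dispersion n x"
proof -
  define t where "t = sqrt (sq_norm {..<n} x / n)"
  have t: "t \<ge> 0" "t\<^sup>2 = sq_norm {..<n} x / n" by (simp_all add: t_def sum_nonneg)
  have "sq_dist {..<n} (unit_vector n x) (\<lambda>k. x k / sqrt n)
      = sq_norm {..<n} (unit_vector n x) - 2 * dot {..<n} (unit_vector n x) x / sqrt n
        + sq_norm {..<n} x / n"
    by (simp add: power2_diff sum.distrib sum_subtractf power_divide sum_distrib_left
        sum_divide_distrib mult.assoc)
  also have "\<dots> = 1 - 2 * t + t\<^sup>2"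
    unfolding sq_norm_unit_vector[OF assms] dot_unit_vector t(2) by (simp add: t_def real_sqrt_divide)
  also have "\<dots> = (1 - t)\<^sup>2 * 1" by (simp add: power2_diff)
  also have "\<dots> \<le> (1 - t)\<^sup>2 * (1 + t)\<^sup>2" using t by (intro mult_left_mono) (auto simp: one_le_power)
  also have "\<dots> = (t\<^sup>2 - 1)\<^sup>2" by (simp add: power2_eq_square algebra_simps)
  finally show ?thesis by (simp add: dispersion_def t)
qed

definition cell :: "nat \<Rightarrow> (nat \<Rightarrow> real) \<Rightarrow> nat \<Rightarrow> int" where
  "cell n x = (\<lambda>k\<in>{..<n}. \<lfloor>n * unit_vector n x k\<rfloor>)"

abbreviation cells :: "nat \<Rightarrow> (nat \<Rightarrow> int) set" where
  "cells n \<equiv> PiE {..<n} (\<lambda>_. {- int n..int n})"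

lemma finite_cells: "finite (cells n)"
  by (intro finite_PiE) simp_all

lemma measurable_cell: "cell n \<in> gauss_on {..<n} \<rightarrow>\<^sub>M count_space (cells n)"
proof -
  have "(\<lambda>x. \<lfloor>n * unit_vector n x k\<rfloor>) \<in> gauss_on {..<n} \<rightarrow>\<^sub>M count_space {- int n..int n}"
    if "k < n" for k
  proof (rule measurable_count_space_extend)
    have "\<lfloor>n * unit_vector n x k\<rfloor> \<in> {- int n..int n}" for x
    proof -
      have "\<bar>n * unit_vector n x k\<bar> \<le> real n * 1"
        unfolding abs_mult using abs_unit_vector_le_1[OF that] by (intro mult_mono) simp_all
      then have "- real n \<le> n * unit_vector n x k" "n * unit_vector n x k < real n + 1"
        by (simp_all add: abs_le_iff)
      then show ?thesis by (simp add: le_floor_iff floor_le_iff)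
    qed
    then show "(\<lambda>x. \<lfloor>n * unit_vector n x k\<rfloor>) \<in> space (gauss_on {..<n}) \<rightarrow> {- int n..int n}"
      by blast
    show "(\<lambda>x. \<lfloor>n * unit_vector n x k\<rfloor>) \<in> gauss_on {..<n} \<rightarrow>\<^sub>M count_space UNIV"
      using that by measurable
  qed simp
  then have "cell n \<in> gauss_on {..<n} \<rightarrow>\<^sub>M PiM {..<n} (\<lambda>_. count_space {- int n..int n})"
    unfolding cell_def[abs_def] by (intro measurable_restrict) simp
  then show ?thesis
    by (simp add: count_space_PiM_finite)
qed

lemma sq_dist_le_of_cell_eq:
  assumes "n > 0" "cell n x = cell n y"
  shows "sq_dist {..<n} (unit_vector n x) (unit_vector n y) \<le> 1 / n"
proof -
  have "\<bar>unit_vector n x k - unit_vector n y k\<bar> \<le> 1 / n" if "k < n" for k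
  proof -
    have "\<lfloor>n * unit_vector n x k\<rfloor> = \<lfloor>n * unit_vector n y k\<rfloor>"
      using fun_cong[OF assms(2), of k] that by (simp add: cell_def)
    then have "\<bar>n * unit_vector n x k - n * unit_vector n y k\<bar> \<le> 1" by linarith
    then have "n * \<bar>unit_vector n x k - unit_vector n y k\<bar> \<le> 1"
      by (simp add: abs_mult flip: right_diff_distrib)
    then show ?thesis
      using assms(1) by (simp add: field_simps)
  qed
  then have "sq_dist {..<n} (unit_vector n x) (unit_vector n y) \<le> (\<Sum>k<n. (1 / n)\<^sup>2)"
    by (intro sum_mono power2_le_iff_abs_le[THEN iffD2]) auto
  also have "\<dots> = 1 / n" using assms(1) by (simp add: power2_eq_square)
  finally show ?thesis .
qed

definition vertex :: "nat \<Rightarrow> (nat \<Rightarrow> real) \<Rightarrow> nat" where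
  "vertex n x = to_nat_on (cells n) (cell n x)"

definition center :: "nat \<Rightarrow> nat \<Rightarrow> nat \<Rightarrow> real" where
  "center n i = unit_vector n (inv_into (space (gauss_on {..<n})) (vertex n) i)"

lemma measurable_vertex: "vertex n \<in> gauss_on {..<n} \<rightarrow>\<^sub>M count_space {..<(2 * n + 1) ^ n}"
proof -
  have "card (cells n) = (2 * n + 1) ^ n"
    by (simp add: card_PiE nat_add_distrib nat_mult_distrib)
  then have "to_nat_on (cells n) \<in> cells n \<rightarrow> {..<(2 * n + 1) ^ n}"
    using to_nat_on_finite[OF finite_cells, of n] by (auto simp: bij_betw_def)
  then show ?thesis
    unfolding vertex_def[abs_def] by (intro measurable_compose[OF measurable_cell]) simp
qed

lemma sq_norm_center: "n > 0 \<Longrightarrow> sq_norm {..<n} (center n i) = 1"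
  by (simp add: center_def sq_norm_unit_vector)

lemma center_vertex_near:
  assumes "n > 0" and x: "x \<in> space (gauss_on {..<n})"
  shows "sq_dist {..<n} (center n (vertex n x)) (unit_vector n x) \<le> 1 / n"
proof -
  define y where "y = inv_into (space (gauss_on {..<n})) (vertex n) (vertex n x)"
  have y: "y \<in> space (gauss_on {..<n})" "vertex n y = vertex n x"
    using x by (auto simp: y_def f_inv_into_f intro: inv_into_into)
  have "inj_on (to_nat_on (cells n)) (cells n)"
    using finite_cells by (intro inj_on_to_nat_on countable_finite)
  then have "cell n y = cell n x"
    using y(2) measurable_space[OF measurable_cell y(1)] measurable_space[OF measurable_cell x]
    by (simp add: vertex_def inj_on_eq_iff)
  then show ?thesis
    unfolding center_def y_def[symmetric] by (rule sq_dist_le_of_cell_eq[OF \<open>n > 0\<close>])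
qed

lemma sq_dist_triangle:
  "sq_dist K x y \<le> 2 * sq_dist K x z + 2 * sq_dist K z y"
proof -
  have "(x k - y k)\<^sup>2 \<le> 2 * (x k - z k)\<^sup>2 + 2 * (z k - y k)\<^sup>2" for k
    using sum_squares_bound[of "x k - z k" "z k - y k"] by (simp add: power2_eq_square algebra_simps)
  then show ?thesis unfolding sum_distrib_left sum.distrib[symmetric] by (rule sum_mono)
qed

lemma center_vertex_near_rescaled:
  assumes "n > 0" "x \<in> space (gauss_on {..<n})"
  shows "sq_dist {..<n} (center n (vertex n x)) (\<lambda>k. x k / sqrt n) \<le> 2 / n + 2 * dispersion n x"
proof -
  have "sq_dist {..<n} (center n (vertex n x)) (\<lambda>k. x k / sqrt n)
      \<le> 2 * sq_dist {..<n} (center n (vertex n x)) (unit_vector n x)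
        + 2 * sq_dist {..<n} (unit_vector n x) (\<lambda>k. x k / sqrt n)"
    by (rule sq_dist_triangle)
  also have "\<dots> \<le> 2 * (1 / n) + 2 * dispersion n x"
    using center_vertex_near[OF assms] unit_vector_near_rescaled[OF assms(1)]
    by (intro add_mono mult_left_mono) simp_all
  finally show ?thesis by simp
qed

lemma mult_le_weighted_squares:
  fixes u v \<kappa> :: real
  assumes "\<kappa> > 0"
  shows "u * v \<le> \<kappa> / 2 * u\<^sup>2 + 1 / (2 * \<kappa>) * v\<^sup>2"
proof -
  have "0 \<le> (\<kappa> * u - v)\<^sup>2 / (2 * \<kappa>)" using assms by simp
  also have "\<dots> = \<kappa> / 2 * u\<^sup>2 + 1 / (2 * \<kappa>) * v\<^sup>2 - u * v"
    using assms by (simp add: power2_diff field_simps power2_eq_square)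
  finally show ?thesis by simp
qed

lemma dot_perturb_le:
  assumes "\<kappa> > 0"
  shows "dot K a b \<le> dot K a' b'
    + \<kappa> / 2 * (sq_dist K a a' + sq_dist K b b')
    + 1 / (2 * \<kappa>) * (sq_norm K b + sq_norm K a')"
proof -
  have "a k * b k \<le> a' k * b' k + \<kappa> / 2 * ((a k - a' k)\<^sup>2 + (b k - b' k)\<^sup>2)
      + 1 / (2 * \<kappa>) * ((b k)\<^sup>2 + (a' k)\<^sup>2)" for k
  proof -
    have "a k * b k = a' k * b' k + (a k - a' k) * b k + (b k - b' k) * a' k"
      by (simp add: algebra_simps)
    also have "\<dots> \<le> a' k * b' k + (\<kappa> / 2 * (a k - a' k)\<^sup>2 + 1 / (2 * \<kappa>) * (b k)\<^sup>2)
        + (\<kappa> / 2 * (b k - b' k)\<^sup>2 + 1 / (2 * \<kappa>) * (a' k)\<^sup>2)"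
      by (intro add_mono order_refl mult_le_weighted_squares assms)
    finally show ?thesis by (simp add: algebra_simps)
  qed
  then have "dot K a b \<le> (\<Sum>k\<in>K. a' k * b' k + \<kappa> / 2 * ((a k - a' k)\<^sup>2 + (b k - b' k)\<^sup>2)
      + 1 / (2 * \<kappa>) * ((b k)\<^sup>2 + (a' k)\<^sup>2))"
    by (rule sum_mono)
  then show ?thesis by (simp only: sum.distrib flip: sum_distrib_left)
qed

lemma dot_center_vertex_le:
  assumes "n > 0" and x: "x \<in> space (gauss_on {..<n})" and y: "y \<in> space (gauss_on {..<n})"
  shows "dot {..<n} (center n (vertex n x)) (center n (vertex n y))
    \<le> dot {..<n} x y / n + sqrt n / 2 * (4 / n + (2 * dispersion n x + 2 * dispersion n y))
      + 1 / (2 * sqrt n) * (1 + dot {..<n} x x / n)"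
proof -
  let ?c = "\<lambda>x. center n (vertex n x)" and ?r = "\<lambda>x k. x k / sqrt n"
  have "dot {..<n} (?c x) (?c y) \<le> dot {..<n} (?r x) (?r y)
      + sqrt n / 2 * (sq_dist {..<n} (?c x) (?r x) + sq_dist {..<n} (?c y) (?r y))
      + 1 / (2 * sqrt n) * (sq_norm {..<n} (?c y) + sq_norm {..<n} (?r x))"
    using \<open>n > 0\<close> by (intro dot_perturb_le) simp
  also have "dot {..<n} (?r x) (?r y) = dot {..<n} x y / n"
    by (simp add: sum_divide_distrib)
  also have "sq_norm {..<n} (?r x) = dot {..<n} x x / n"
    by (simp add: power_divide power2_eq_square sum_divide_distrib)
  also have "sq_norm {..<n} (?c y) = 1"
    by (rule sq_norm_center[OF \<open>n > 0\<close>])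
  also have "sq_dist {..<n} (?c x) (?r x) + sq_dist {..<n} (?c y) (?r y)
      \<le> 4 / n + (2 * dispersion n x + 2 * dispersion n y)"
    using center_vertex_near_rescaled[OF \<open>n > 0\<close> x] center_vertex_near_rescaled[OF \<open>n > 0\<close> y]
    by simp
  finally show ?thesis by (simp add: mult_left_mono)
qed

lemma has_bochner_integral_mat_vec:
  fixes f :: "('i \<Rightarrow> real) \<Rightarrow> real"
  assumes "finite I" "I \<noteq> {}" "finite J" "sq_norm J a = 1"
    and f: "has_bochner_integral (gauss_on I) f r"
  shows "has_bochner_integral (gauss_on (I \<times> J)) (\<lambda>Z. f (mat_vec I J Z a)) r"
  using f borel_measurable_has_bochner_integral[OF f] distr_mat_vec[OF assms(1-4)]
  by (metis has_bochner_integral_iff integrable_distr_eq integral_distr measurable_mat_vec)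

lemma has_bochner_integral_dot_center_vertex_bound:
  assumes "n > 0" "finite J" and a: "sq_norm J a = 1" and "sq_norm J b = 1"
  shows "has_bochner_integral (gauss_on ({..<n} \<times> J))
    (\<lambda>Z. dot {..<n} (mat_vec {..<n} J Z a) (mat_vec {..<n} J Z b) / n
      + sqrt n / 2 * (4 / n + (2 * dispersion n (mat_vec {..<n} J Z a)
        + 2 * dispersion n (mat_vec {..<n} J Z b)))
      + 1 / (2 * sqrt n) * (1 + dot {..<n} (mat_vec {..<n} J Z a) (mat_vec {..<n} J Z a) / n))
    (dot J a b + 7 / sqrt n)"
    (is "has_bochner_integral ?G ?B _")
proof -
  have const: "has_bochner_integral ?G (\<lambda>_. r) r" for r :: real
    by (simp add: has_bochner_integral_iff gauss_on.prob_space)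
  have "has_bochner_integral ?G ?B
      (card {..<n} * dot J a b / n + sqrt n / 2 * (4 / n + (2 * (2 / n) + 2 * (2 / n)))
      + 1 / (2 * sqrt n) * (1 + card {..<n} * dot J a a / n))"
    using assms
    by (intro has_bochner_integral_add has_bochner_integral_mult_right has_bochner_integral_divide
        const has_bochner_integral_mat_vec[where f = "dispersion n"]
        has_bochner_integral_dot_mat_vec has_bochner_integral_dispersion)
      (simp_all add: lessThan_empty_iff)
  moreover have "sqrt n / 2 * (4 / n + (2 * (2 / n) + 2 * (2 / n))) = 6 / sqrt n"
  proof -
    have "sqrt n / n = 1 / sqrt n" using \<open>n > 0\<close> by (simp add: real_div_sqrt divide_simps)
    then show ?thesis by simp
  qed
  ultimately show ?thesis
    using \<open>n > 0\<close> a by (simp add: power2_eq_square add.commute[of "dot J a b"] flip: add_divide_distrib)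
qed

lemma integral_dot_center_vertex_le:
  assumes "n > 0" "finite J" "sq_norm J a = 1" "sq_norm J b = 1"
  shows "(\<integral>Z. dot {..<n} (center n (vertex n (mat_vec {..<n} J Z a)))
        (center n (vertex n (mat_vec {..<n} J Z b)))
      \<partial>gauss_on ({..<n} \<times> J)) \<le> dot J a b + 7 / sqrt n"
proof -
  let ?G = "gauss_on ({..<n} \<times> J)"
  let ?V = "{..<(2 * n + 1) ^ n}"
  let ?X = "\<lambda>a Z. vertex n (mat_vec {..<n} J Z a)"
  note bound = has_bochner_integral_dot_center_vertex_bound[OF assms]
  have "(\<lambda>Z. (?X a Z, ?X b Z)) \<in> ?G \<rightarrow>\<^sub>M count_space (?V \<times> ?V)"
    by (intro measurable_Pair_count_space measurable_compose[OF measurable_mat_vec measurable_vertex])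
       simp_all
  from gauss_on.integrable_finite_range[OF this, of "\<lambda>(i, j). dot {..<n} (center n i) (center n j)"]
  have integrable: "integrable ?G (\<lambda>Z. dot {..<n} (center n (?X a Z)) (center n (?X b Z)))"
    by simp
  show ?thesis
    unfolding has_bochner_integral_integral_eq[OF bound, symmetric]
    using integrable
    by (intro integral_mono dot_center_vertex_le \<open>n > 0\<close> measurable_space[OF measurable_mat_vec]
        integrable.intros[OF bound]) auto
qed

section \<open>The Gaussian graph\<close>

lemma integral_corr_partner:
  fixes g :: "(nat \<Rightarrow> real) \<times> (nat \<Rightarrow> real) \<Rightarrow> real"
  assumes g: "g \<in> borel_measurable (gauss n \<Otimes>\<^sub>M gauss n)"
  shows "(\<integral>p. g (fst p, corr_partner n \<rho> (fst p) (snd p)) \<partial>(gauss n \<Otimes>\<^sub>M gauss n))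
    = (\<integral>Z. g (mat_vec {..<n} {..<2} Z (planar_unit 1), mat_vec {..<n} {..<2} Z (planar_unit \<rho>))
        \<partial>gauss_on ({..<n} \<times> {..<2}))"
proof -
  let ?I = "{..<n}"
  let ?G = "gauss_on (?I \<times> {..<2::nat})"
  let ?col = "\<lambda>Z. (\<lambda>i\<in>?I. Z (i, 0), \<lambda>i\<in>?I. Z (i, 1))"
  have col: "?col \<in> ?G \<rightarrow>\<^sub>M gauss n \<Otimes>\<^sub>M gauss n"
    unfolding gauss_def by measurable
  have "(\<lambda>p. (fst p, corr_partner n \<rho> (fst p) (snd p))) \<in> gauss n \<Otimes>\<^sub>M gauss n \<rightarrow>\<^sub>M gauss n \<Otimes>\<^sub>M gauss n"
    unfolding corr_partner_def gauss_def by measurable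
  from measurable_compose[OF this g]
  have "(\<integral>Z. g (fst (?col Z), corr_partner n \<rho> (fst (?col Z)) (snd (?col Z))) \<partial>?G)
      = (\<integral>p. g (fst p, corr_partner n \<rho> (fst p) (snd p)) \<partial>distr ?G (gauss n \<Otimes>\<^sub>M gauss n) ?col)"
    by (intro integral_distr[symmetric] col)
  also have "distr ?G (gauss n \<Otimes>\<^sub>M gauss n) ?col = gauss n \<Otimes>\<^sub>M gauss n"
    unfolding gauss_def by (intro distr_gauss_on_columns) simp_all
  finally show ?thesis
    by (simp add: corr_partner_def mat_vec_planar_unit restrict_def cong: if_cong)
qed

lemma inner_f_opt3: "inner (f_opt3 x) (f_opt3 y) = dot {..<3} (direction {..<3} x) (direction {..<3} y)"
proof -
  have "norm (vector [x 0, x 1, x 2] :: real^3) = sqrt (sq_norm {..<3} x)" for x :: "nat \<Rightarrow> real"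
    by (simp add: norm_eq_sqrt_inner inner_vec_def sum_3 power2_eq_square eval_nat_numeral)
  then show ?thesis
    by (simp add: f_opt3_def Let_def inner_vec_def sum_3 direction_def eval_nat_numeral)
qed

lemma Stab_f_opt3:
  assumes "n \<ge> 3"
  shows "Stab n \<rho> f_opt3 = Fstar 3 \<rho>"
proof -
  let ?G = "\<lambda>m. gauss_on ({..<m} \<times> {..<2::nat})"
  let ?u = "planar_unit 1" and ?v = "planar_unit \<rho>"
  let ?r = "\<lambda>Z. restrict Z ({..<3} \<times> {..<2})"
  have [measurable]: "(\<lambda>x. x i) \<in> borel_measurable (gauss n)" if "i < 3" for i
    using assms that unfolding gauss_def by simp
  have "(\<lambda>p. dot {..<3} (direction {..<3} (fst p)) (direction {..<3} (snd p)))
      \<in> borel_measurable (gauss n \<Otimes>\<^sub>M gauss n)"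
    unfolding direction_def by measurable
  from integral_corr_partner[OF this]
  have "Stab n \<rho> f_opt3 = (\<integral>Z. dot {..<3} (direction {..<3} (mat_vec {..<n} {..<2} Z ?u))
      (direction {..<3} (mat_vec {..<n} {..<2} Z ?v)) \<partial>?G n)"
    by (simp add: Stab_def inner_f_opt3)
  also have "\<dots> = (\<integral>Z. dot {..<3} (gauss_round 3 {..<2} ?u (?r Z)) (gauss_round 3 {..<2} ?v (?r Z))
      \<partial>?G n)"
    using assms
    by (intro Bochner_Integration.integral_cong refl sum.cong arg_cong2[where f = "(*)"])
       (simp_all add: gauss_round_def direction_def mat_vec_def)
  also have "\<dots> = (\<integral>Z. dot {..<3} (gauss_round 3 {..<2} ?u Z) (gauss_round 3 {..<2} ?v Z)
      \<partial>distr (?G n) (?G 3) ?r)"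
    unfolding gauss_on_def using assms
    by (intro integral_distr[symmetric] measurable_restrict_subset) (auto simp flip: gauss_on_def)
  also have "distr (?G n) (?G 3) ?r = ?G 3"
    unfolding gauss_on_def using assms by (intro std_normal_product.distr_PiM_restrict_finite) auto
  finally show ?thesis by (simp add: Fstar_planar_unit)
qed

lemma H3_imp_Fstar_le:
  fixes f :: "(nat \<Rightarrow> real) \<Rightarrow> real^3"
  assumes "H3" "-1 \<le> \<rho>" "\<rho> \<le> 0" "n \<ge> 3"
    and f [measurable]: "f \<in> borel_measurable (gauss n)"
    and "\<And>x. x \<in> space (gauss n) \<Longrightarrow> norm (f x) \<le> 1"
  shows "Fstar 3 \<rho> \<le> (\<integral>Z. inner (f (mat_vec {..<n} {..<2} Z (planar_unit 1)))
      (f (mat_vec {..<n} {..<2} Z (planar_unit \<rho>))) \<partial>gauss_on ({..<n} \<times> {..<2}))"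
proof -
  have "Fstar 3 \<rho> \<le> Stab n \<rho> f"
    unfolding Stab_f_opt3[OF \<open>n \<ge> 3\<close>, symmetric] using assms by (auto simp: H3_def)
  then show ?thesis
    using integral_corr_partner[of "\<lambda>p. inner (f (fst p)) (f (snd p))" n \<rho>] by (simp add: Stab_def)
qed

lemma gaussian_graph_ratio_le:
  fixes n :: nat
  assumes "H3" and \<rho>: "-1 \<le> \<rho>" "\<rho> \<le> 0" and "n \<ge> 3" and pos: "\<rho> + 7 / sqrt n < 1"
  obtains N w where "weighted_graph N w"
    "ProdG N w / SDP_Prod N w \<le> (1 - Fstar 3 \<rho>) / (1 - (\<rho> + 7 / sqrt n))"
proof -
  let ?N = "(2 * n + 1) ^ n"
  let ?G = "gauss_on ({..<n} \<times> {..<2::nat})"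
  let ?X = "\<lambda>\<rho> Z. vertex n (mat_vec {..<n} {..<2} Z (planar_unit \<rho>))"
  have X: "?X \<rho> \<in> ?G \<rightarrow>\<^sub>M count_space {..<?N}" for \<rho>
    by (rule measurable_compose[OF measurable_mat_vec measurable_vertex])
  have "n < 2 ^ n" by simp
  also have "(2::nat) ^ n \<le> ?N" using \<open>n \<ge> 3\<close> by (intro power_mono) simp_all
  finally have "n \<le> ?N" by simp
  have sdp: "(\<integral>Z. dot {..<n} (center n (?X 1 Z)) (center n (?X \<rho> Z)) \<partial>?G) \<le> \<rho> + 7 / sqrt n"
    using integral_dot_center_vertex_le[of n "{..<2}" "planar_unit 1" "planar_unit \<rho>"] \<open>n \<ge> 3\<close> \<rho>
    by (simp add: sq_norm_planar_unit dot_planar_unit)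
  have prod: "Fstar 3 \<rho> \<le> (\<integral>Z. inner (f (?X 1 Z)) (f (?X \<rho> Z)) \<partial>?G)"
    if f: "\<And>i. i < ?N \<Longrightarrow> norm (f i) = 1" for f :: "nat \<Rightarrow> real^3"
  proof (rule H3_imp_Fstar_le[OF \<open>H3\<close> \<rho> \<open>n \<ge> 3\<close>])
    show "(\<lambda>x. f (vertex n x)) \<in> borel_measurable (gauss n)"
      unfolding gauss_def by (rule measurable_compose[OF measurable_vertex]) simp
    show "norm (f (vertex n x)) \<le> 1" if "x \<in> space (gauss n)" for x
      using measurable_space[OF measurable_vertex] that f by (simp add: gauss_def)
  qed
  obtain w where "weighted_graph ?N w"
    "ProdG ?N w / SDP_Prod ?N w \<le> (1 - Fstar 3 \<rho>) / (1 - (\<rho> + 7 / sqrt n))"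
    by (rule gauss_on.exists_weighted_graph_ratio_le[OF X X \<open>n \<le> ?N\<close> _ sdp pos prod])
       (use \<open>n \<ge> 3\<close> in \<open>auto intro: sq_norm_center\<close>)
  then show thesis by (rule that)
qed

definition integrality_ratio :: real where
  "integrality_ratio =
    (INF G \<in> {(N, w). weighted_graph N w}. ProdG (fst G) (snd G) / SDP_Prod (fst G) (snd G))"

lemma integrality_ratio_le:
  assumes "weighted_graph N w" "ProdG N w / SDP_Prod N w \<le> r"
  shows "integrality_ratio \<le> r"
  unfolding integrality_ratio_def
proof (rule cINF_lower2)
  show "bdd_below ((\<lambda>G. ProdG (fst G) (snd G) / SDP_Prod (fst G) (snd G))
      ` {(N, w). weighted_graph N w})"
    by (rule bdd_belowI2[of _ alpha_BOV]) (auto intro: alpha_BOV_le_ratio)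
  show "(N, w) \<in> {(N, w). weighted_graph N w}"
    using assms(1) by simp
qed (use assms(2) in simp)

lemma alpha_BOV_le_integrality_ratio: "alpha_BOV \<le> integrality_ratio"
  unfolding integrality_ratio_def
proof (rule cINF_greatest)
  have "(2, \<lambda>_ _. 1) \<in> {(N, w). weighted_graph N w}"
    by (simp add: weighted_graph_def numeral_2_eq_2)
  then show "{(N, w). weighted_graph N w} \<noteq> {}" by blast
qed (auto intro: alpha_BOV_le_ratio)

lemma integrality_ratio_le_of_nonpos:
  assumes "H3" and \<rho>: "-1 \<le> \<rho>" "\<rho> \<le> 0"
  shows "integrality_ratio \<le> (1 - Fstar 3 \<rho>) / (1 - \<rho>)"
proof (rule tendsto_lowerbound)
  have error: "(\<lambda>n. \<rho> + 7 / sqrt (real n)) \<longlonglongrightarrow> \<rho>"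
    by real_asymp
  then show "(\<lambda>n. (1 - Fstar 3 \<rho>) / (1 - (\<rho> + 7 / sqrt (real n)))) \<longlonglongrightarrow> (1 - Fstar 3 \<rho>) / (1 - \<rho>)"
    using \<rho> by (intro tendsto_intros) auto
  have "\<forall>\<^sub>F n in sequentially. \<rho> + 7 / sqrt (real n) < 1"
    using error \<rho> by (intro order_tendstoD(2)) auto
  then show "\<forall>\<^sub>F n in sequentially. integrality_ratio \<le> (1 - Fstar 3 \<rho>) / (1 - (\<rho> + 7 / sqrt (real n)))"
    using eventually_ge_at_top[of "3::nat"]
  proof eventually_elim
    case (elim n)
    then obtain N w where "weighted_graph N w"
      "ProdG N w / SDP_Prod N w \<le> (1 - Fstar 3 \<rho>) / (1 - (\<rho> + 7 / sqrt n))"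
      using gaussian_graph_ratio_le[OF assms] by blast
    then show ?case by (rule integrality_ratio_le)
  qed
qed simp

lemma integrality_ratio_le_of_pos:
  assumes "H3" and \<rho>: "0 < \<rho>" "\<rho> < 1"
  shows "integrality_ratio \<le> (1 - Fstar 3 \<rho>) / (1 - \<rho>)"
proof -
  have "integrality_ratio \<le> 1"
    using integrality_ratio_le_of_nonpos[OF assms(1), of 0] by (simp add: Fstar_0)
  also have "1 \<le> (1 - Fstar 3 \<rho>) / (1 - \<rho>)"
    using \<rho> Fstar_le_self[of \<rho>] by simp
  finally show ?thesis .
qed

theorem theorem2p8:
  assumes "H3"
  shows "(INF G \<in> {(N, w). weighted_graph N w}. ProdG (fst G) (snd G) / SDP_Prod (fst G) (snd G)) = alpha_BOV"
  unfolding integrality_ratio_def[symmetric]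
proof (rule antisym)
  show "integrality_ratio \<le> alpha_BOV"
    unfolding alpha_BOV_def
  proof (rule cINF_greatest)
    fix \<rho> :: real assume "\<rho> \<in> {-1..<1}"
    then consider "-1 \<le> \<rho>" "\<rho> \<le> 0" | "0 < \<rho>" "\<rho> < 1" by fastforce
    then show "integrality_ratio \<le> (1 - Fstar 3 \<rho>) / (1 - \<rho>)"
      using integrality_ratio_le_of_nonpos[OF assms] integrality_ratio_le_of_pos[OF assms] by cases
  qed simp
qed (rule alpha_BOV_le_integrality_ratio)

end
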